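(* Let $\mathbb{D}=(\mathbb{R}/L\mathbb{Z})^d$, let $\rho\in L^\infty(\mathbb{D})$ be a probability density, and let $x^1,\dots,x^M$ be independent and identically distributed with law $\rho\,dx$. Let $Z_0>0$ and $\varepsilon_0>0$ be fixed, and for $\varepsilon>0$ put $\zeta=Z_0\varepsilon^{1/2}$ and $$\delta:=\big\|\mathcal{K}^M_{\varepsilon/2}-\mathcal{K}_{\varepsilon/2}\big\|_{H^\infty(\mathbb{D}_\zeta)\to C^0(\mathbb{D})}.$$ Then there exist constants $C_1,C_2>0$ depending only on $L,d,\|\rho\|_0,\varepsilon_0,Z_0$ such that for all $0<\varepsilon<\varepsilon_0$, all $M\ge 1$ and all $0<c<\tfrac34\|\rho\|_0$, $$\mathbb{P}(\delta>c)\le\exp\Big\{C_1\big(\log c^{-1}+\log\varepsilon^{-1}\big)^{2d+1}-C_2\,M\,\varepsilon^{d/2}c^2\Big\}.$$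
   Context: $\|\cdot\|_0$ denotes the sup norm on $\mathbb{D}$. The Gaussian kernel is $g_\varepsilon(x)=(2\pi\varepsilon)^{-d/2}e^{-\|x\|^2/2\varepsilon}$ and its periodisation is $g_{\varepsilon,L}(x)=\sum_{\mathbf{j}\in\mathbb{Z}^d}g_\varepsilon(x+L\mathbf{j})$. The kernel operators are $$(\mathcal{K}_\varepsilon\phi)(x)=\int_{\mathbb{D}}g_{\varepsilon,L}(x-y)\phi(y)\rho(y)\,dy,\qquad(\mathcal{K}^M_\varepsilon\phi)(x)=\frac1M\sum_{i=1}^Mg_{\varepsilon,L}(x-x^i)\phi(x^i).$$ For $\zeta>0$, $\mathbb{D}_\zeta=\{x+iz: x\in\mathbb{D},\ z\in[-\zeta,\zeta]^d\}$, and $H^\infty(\mathbb{D}_\zeta)$ is the space of functions continuous on $\mathbb{D}_\zeta$ and analytic in its interior, with norm $\|\phi\|_\zeta=\sup_{z\in\mathbb{D}_\zeta}|\phi(z)|$. The operators act on $\phi\in H^\infty(\mathbb{D}_\zeta)$ through the restriction of $\phi$ to $\mathbb{D}$.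
   Formalization: The factor log(1/c)+log(1/ε) is replaced by max(1, log(1/c)+log(1/ε)), since the printed bound fails when cε is near or above 1 (e.g. d=L=ρ=M=1, ε=2, c=1/2, Z₀=1/100, ε₀=3); for cε≤θ<1 the printed bound follows with a larger C₁. *)

theory Defs
  imports "HOL-Probability.Probability"
begin

text \<open>
  The torus of side L is modelled by its fundamental cell with Lebesgue measure;
  functions on the torus are L-periodic functions on the covering space. Random points of the torus
  are represented in the cell.
\<close>

definition torus_cell :: "real \<Rightarrow> (real^'n) set" where
  "torus_cell L = {x. \<forall>i. 0 \<le> x $ i \<and> x $ i < L}"

definition torus_measure :: "real \<Rightarrow> (real^'n) measure" where
  "torus_measure L = restrict_space lborel (torus_cell L)"

definition torus_periodic :: "real \<Rightarrow> (real^'n \<Rightarrow> 'b) \<Rightarrow> bool" where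
  "torus_periodic L f \<longleftrightarrow> (\<forall>x k. f (x + axis k L) = f x)"

definition gauss_kernel :: "real \<Rightarrow> real^'n \<Rightarrow> real" where
  "gauss_kernel \<epsilon> x = (2 * pi * \<epsilon>) powr (- (real CARD('n) / 2)) * exp (- ((norm x)\<^sup>2 / (2 * \<epsilon>)))"

definition per_gauss_kernel :: "real \<Rightarrow> real \<Rightarrow> real^'n \<Rightarrow> real" where
  "per_gauss_kernel L \<epsilon> x =
     (\<Sum>\<^sub>\<infinity>j\<in>(UNIV :: (int^'n) set). gauss_kernel \<epsilon> (x + L *\<^sub>R (\<chi> i. of_int (j $ i))))"

definition kernel_op ::
    "real \<Rightarrow> real \<Rightarrow> (real^'n \<Rightarrow> real) \<Rightarrow> (real^'n \<Rightarrow> complex) \<Rightarrow> real^'n \<Rightarrow> complex" where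
  "kernel_op L \<epsilon> \<rho> \<phi> x =
     (LINT y|torus_measure L. of_real (per_gauss_kernel L \<epsilon> (x - y)) * \<phi> y * of_real (\<rho> y))"

definition sampled_kernel_op ::
    "real \<Rightarrow> real \<Rightarrow> nat \<Rightarrow> (nat \<Rightarrow> real^'n) \<Rightarrow> (real^'n \<Rightarrow> complex) \<Rightarrow> real^'n \<Rightarrow> complex" where
  "sampled_kernel_op L \<epsilon> M xs \<phi> x =
     of_real (1 / real M) * (\<Sum>i\<in>{1..M}. of_real (per_gauss_kernel L \<epsilon> (x - xs i)) * \<phi> (xs i))"

definition complex_strip :: "real \<Rightarrow> (complex^'n) set" where
  "complex_strip \<zeta> = {z. \<forall>i. \<bar>Im (z $ i)\<bar> \<le> \<zeta>}"

text \<open>Analyticity in several variables: a complex-linear Frechet derivative at every point.\<close>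

definition holomorphic_several :: "(complex^'n \<Rightarrow> complex) \<Rightarrow> (complex^'n) set \<Rightarrow> bool" where
  "holomorphic_several f S \<longleftrightarrow>
     (\<forall>z\<in>S. \<exists>f'. (f has_derivative f') (at z) \<and> (\<forall>c v. f' (c *s v) = c * f' v))"

text \<open>Only the values on the strip matter; a member is arbitrary outside it.\<close>

definition H_infinity :: "real \<Rightarrow> real \<Rightarrow> (complex^'n \<Rightarrow> complex) set" where
  "H_infinity L \<zeta> = {\<phi>.
     (\<forall>z\<in>complex_strip \<zeta>. \<forall>k. \<phi> (z + axis k (of_real L)) = \<phi> z) \<and>
     continuous_on (complex_strip \<zeta>) \<phi> \<and>
     holomorphic_several \<phi> (interior (complex_strip \<zeta>))}"

definition restrict_real :: "(complex^'n \<Rightarrow> complex) \<Rightarrow> real^'n \<Rightarrow> complex" where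
  "restrict_real \<phi> x = \<phi> (\<chi> i. of_real (x $ i))"

text \<open>Norms are extended reals, so that the suprema are meaningful without boundedness proofs.\<close>

definition sup_norm_on :: "'a set \<Rightarrow> ('a \<Rightarrow> complex) \<Rightarrow> ereal" where
  "sup_norm_on S f = (SUP x\<in>S. ereal (norm (f x)))"

definition op_norm_H_C ::
    "real \<Rightarrow> real \<Rightarrow> ((real^'n \<Rightarrow> complex) \<Rightarrow> real^'n \<Rightarrow> complex) \<Rightarrow> ereal" where
  "op_norm_H_C L \<zeta> T =
     (SUP \<phi>\<in>{\<phi> \<in> H_infinity L \<zeta>. sup_norm_on (complex_strip \<zeta>) \<phi> \<le> 1}.
        sup_norm_on (torus_cell L) (T (restrict_real \<phi>)))"

definition kernel_error ::
    "real \<Rightarrow> real \<Rightarrow> real \<Rightarrow> (real^'n \<Rightarrow> real) \<Rightarrow> nat \<Rightarrow> (nat \<Rightarrow> real^'n) \<Rightarrow> ereal" where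
  "kernel_error L Z\<^sub>0 \<epsilon> \<rho> M xs =
     op_norm_H_C L (Z\<^sub>0 * sqrt \<epsilon>)
       (\<lambda>\<phi> x. sampled_kernel_op L (\<epsilon> / 2) M xs \<phi> x - kernel_op L (\<epsilon> / 2) \<rho> \<phi> x)"

definition bounded_density :: "real \<Rightarrow> real \<Rightarrow> (real^'n \<Rightarrow> real) \<Rightarrow> bool" where
  "bounded_density L R \<rho> \<longleftrightarrow>
     torus_periodic L \<rho> \<and>
     \<rho> \<in> borel_measurable (torus_measure L) \<and>
     (AE x in torus_measure L. 0 \<le> \<rho> x) \<and>
     (\<integral>\<^sup>+ x. ennreal (\<rho> x) \<partial>torus_measure L) = 1 \<and>
     esssup (torus_measure L) (\<lambda>x. ereal \<bar>\<rho> x\<bar>) = ereal R"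

definition iid_sample ::
    "'a measure \<Rightarrow> real \<Rightarrow> (real^'n \<Rightarrow> real) \<Rightarrow> nat \<Rightarrow> (nat \<Rightarrow> 'a \<Rightarrow> real^'n) \<Rightarrow> bool" where
  "iid_sample P L \<rho> M X \<longleftrightarrow>
     prob_space P \<and>
     prob_space.indep_vars P (\<lambda>_. torus_measure L) X {1..M} \<and>
     (\<forall>i\<in>{1..M}. distributed P (torus_measure L) (X i) (\<lambda>x. ennreal (\<rho> x)))"

text \<open>
  The logarithmic factor uses the usual convention of entropy bounds that it is floored at 1.
  The floor is inactive when \<open>c * \<epsilon> \<le> exp (- 1)\<close>; without it the exponent loses its
  positive term at \<open>c * \<epsilon> = 1\<close> and the deviation bound fails, e.g. for the uniform density
  on the unit circle, one sample point, \<open>\<epsilon> = 2\<close>, \<open>c = 1/2\<close> and a strip with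
  \<open>Z\<^sub>0 = 1/100\<close>, where the error exceeds c surely.
\<close>

definition log_factor :: "real \<Rightarrow> real \<Rightarrow> real" where
  "log_factor c \<epsilon> = max 1 (ln (1 / c) + ln (1 / \<epsilon>))"

end

theory Submission
  imports Defs "HOL-Complex_Analysis.Cauchy_Integral_Formula"
begin

text \<open>
  Why the bound holds.  The error at a point \<open>x\<close> is the difference between the empirical mean and
  the mean of the function \<open>F y = g (x - y) * \<phi> y\<close>, where \<open>g\<close> is the periodised Gaussian of variance
  \<open>\<epsilon> / 2\<close>.  This difference has to be controlled for all \<open>x\<close> and all \<open>\<phi>\<close> in the unit ball at once.
  The function \<open>F\<close> is itself analytic in a strip whose width \<open>\<zeta> = Z\<^sub>0 * sqrt \<epsilon>\<close> is comparable to
  the width of the Gaussian.  The torus is cut into \<open>n ^ d\<close> cubes of side \<open>h\<close> comparable to \<open>\<zeta>\<close>.  On one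
  cube \<open>Q\<close>, the Cauchy integral over a polytorus around the centre of \<open>Q\<close>, discretised at \<open>N\<close>th roots of
  unity in every coordinate, expresses \<open>F\<close> as an average of \<open>N ^ d\<close> fixed polynomials with coefficients
  of modulus at most \<open>b Q\<close>, a bound for \<open>F\<close> in a complex neighbourhood of \<open>Q\<close>, up to an error of order
  \<open>b Q / 2 ^ N\<close> (\<open>kernel_local_expansion\<close>).  Neither the cubes nor the polynomials depend on \<open>x\<close> or \<open>\<phi>\<close>; only the
  coefficients do.

  Consequently a finite family of \<open>n ^ d * N ^ d\<close> bounded test functions controls the supremum: if all their
  empirical means are within \<open>t\<close> of the true means, then the error is at most
  \<open>t * (\<Sum>Q. b Q)\<close> plus the truncation error (\<open>kernel_error_le\<close>).  The sum of the
  \<open>b Q\<close> is a Riemann sum for a Gaussian, hence at most a constant times \<open>\<epsilon> powr (- d / 2)\<close>, uniformly in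
  \<open>x\<close> (\<open>cube_gauss_sum_bounded\<close>).  It therefore suffices to take \<open>t\<close> proportional to
  \<open>c * \<epsilon> powr (d / 2)\<close>.

  A test function lives on one cube, so its second moment is at most a constant times \<open>R * \<zeta> ^ d\<close>,
  of order \<open>\<epsilon> powr (d / 2)\<close>.  A Chernoff bound that sees the variance
  (\<open>chernoff_variance_bound\<close>) then gives each deviation probability
  at most \<open>exp (- C\<^sub>2 * M * \<epsilon> powr (d / 2) * c\<^sup>2)\<close>: the exponent has order \<open>M * t\<^sup>2\<close> divided by
  the second moment, \<open>t\<^sup>2\<close> has order \<open>c\<^sup>2 * \<epsilon> ^ d\<close>, and the division removes half of that power of \<open>\<epsilon>\<close>.  The number of test functions is
  polynomial in \<open>1 / \<epsilon>\<close> and \<open>1 / c\<close>, so the union bound contributes \<open>exp (C\<^sub>1 * l)\<close> with \<open>l\<close>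
  the logarithmic factor, and \<open>l \<le> l ^ (2 * d + 1)\<close> because \<open>l \<ge> 1\<close>.
\<close>

section \<open>Exponential moments and deviations of empirical means\<close>

lemma exp_le_one_plus_quadratic:
  fixes s :: real
  assumes "s \<le> 1"
  shows "exp s \<le> 1 + s + s\<^sup>2"
proof (cases "0 \<le> s")
  case True
  then show ?thesis using exp_bound[of s] assms by simp
next
  case False
  define y where "y = - s"
  have y: "y > 0" using False by (simp add: y_def)
  have "1 \<le> 1 + y ^ 3" using y by simp
  also have "\<dots> = (1 + y) * (1 - y + y\<^sup>2)"
    by (simp add: algebra_simps power2_eq_square power3_eq_cube)
  also have "\<dots> \<le> exp y * (1 - y + y\<^sup>2)"
  proof (rule mult_right_mono)
    show "1 + y \<le> exp y" by (rule exp_ge_add_one_self)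
    have "1 - y + y\<^sup>2 = (1 - y / 2)\<^sup>2 + 3 / 4 * y\<^sup>2"
      by (simp add: power2_eq_square field_simps)
    then show "0 \<le> 1 - y + y\<^sup>2" by simp
  qed
  finally have "exp (- y) * 1 \<le> exp (- y) * (exp y * (1 - y + y\<^sup>2))"
    by (intro mult_left_mono) auto
  also have "\<dots> = 1 - y + y\<^sup>2" by (simp add: exp_minus)
  finally show ?thesis by (simp add: y_def)
qed

text \<open>
  The exponential moment method with \<open>exp s \<le> 1 + s + s\<^sup>2\<close> instead of a bound by the range of
  \<open>Y\<close>: the quadratic term of the exponent is then the second moment of \<open>Y\<close>. For the test functions used
  below the second moment is much smaller than the squared range.
  The parameter \<open>h\<close> is left free so that the caller can choose it proportional to the deviation.
\<close>

lemma (in prob_space) chernoff_variance_bound: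
  fixes Y :: "'b \<Rightarrow> real"
  assumes indep: "indep_vars (\<lambda>_. N) X I" and fin: "finite I"
    and distr: "\<And>i. i \<in> I \<Longrightarrow> distr M N (X i) = D"
    and Y: "Y \<in> borel_measurable N" and bound: "\<And>x. \<bar>Y x\<bar> \<le> B"
    and var: "(\<integral>x. (Y x)\<^sup>2 \<partial>D) \<le> v"
    and lam: "0 \<le> h" "h * B \<le> 1"
  shows "prob {\<omega> \<in> space M. real (card I) * ((\<integral>x. Y x \<partial>D) + t) \<le> (\<Sum>i\<in>I. Y (X i \<omega>))}
           \<le> exp (real (card I) * (h\<^sup>2 * v - h * t))"
proof (cases "I = {}")
  case True
  then show ?thesis by (simp add: prob_space)
next
  case False
  have rv: "X i \<in> measurable M N" if "i \<in> I" for i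
    using indep that by (auto simp: indep_vars_def)
  have setsD: "sets D = sets N"
    using distr False by force
  have probD: "prob_space D"
    using False distr rv prob_space_distr by (metis all_not_in_conv)
  interpret D: prob_space D by fact
  have YD: "Y \<in> borel_measurable D"
    using Y measurable_cong_sets[OF setsD refl] by blast
  define m where "m = (\<integral>x. Y x \<partial>D)"
  have B0: "0 \<le> B" using bound[of undefined] by linarith
  have exp_bd: "\<bar>exp (h * Y x)\<bar> \<le> exp 1" for x
  proof -
    have "h * Y x \<le> h * B" using bound[of x] lam by (intro mult_left_mono) auto
    then show ?thesis using lam by simp
  qed
  have intY: "integrable D Y"
    by (rule D.integrable_const_bound[where B = B]) (use bound YD in auto)
  have intY2: "integrable D (\<lambda>x. (Y x)\<^sup>2)"
  proof (rule D.integrable_const_bound[where B = "B\<^sup>2"])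
    show "AE x in D. norm ((Y x)\<^sup>2) \<le> B\<^sup>2"
    proof (rule AE_I2)
      fix x
      have "\<bar>Y x\<bar>\<^sup>2 \<le> B\<^sup>2" using bound[of x] by (intro power_mono) auto
      then show "norm ((Y x)\<^sup>2) \<le> B\<^sup>2" by simp
    qed
  qed (use YD in auto)
  have intE: "integrable D (\<lambda>x. exp (h * Y x))"
    by (rule D.integrable_const_bound[where B = "exp 1"]) (use exp_bd YD in auto)
  have mgf: "(\<integral>x. exp (h * Y x) \<partial>D) \<le> exp (h * m + h\<^sup>2 * v)"
  proof -
    have "(\<integral>x. exp (h * Y x) \<partial>D) \<le> (\<integral>x. 1 + h * Y x + h\<^sup>2 * (Y x)\<^sup>2 \<partial>D)"
    proof (rule integral_mono)
      fix x
      have "h * Y x \<le> h * B" using bound[of x] lam by (intro mult_left_mono) auto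
      then have "h * Y x \<le> 1" using lam by simp
      from exp_le_one_plus_quadratic[OF this]
      show "exp (h * Y x) \<le> 1 + h * Y x + h\<^sup>2 * (Y x)\<^sup>2" by (simp add: power_mult_distrib)
    qed (use intE intY intY2 in auto)
    also have "\<dots> = 1 + h * m + h\<^sup>2 * (\<integral>x. (Y x)\<^sup>2 \<partial>D)"
      using intY intY2 by (simp add: m_def D.prob_space)
    also have "\<dots> \<le> 1 + (h * m + h\<^sup>2 * v)"
      using var by (simp add: mult_left_mono)
    also have "\<dots> \<le> exp (h * m + h\<^sup>2 * v)" by (rule exp_ge_add_one_self)
    finally show ?thesis .
  qed
  define G where "G = (\<lambda>\<omega>. \<Prod>i\<in>I. exp (h * Y (X i \<omega>)))"
  have ind: "indep_vars (\<lambda>_. borel) (\<lambda>i \<omega>. exp (h * Y (X i \<omega>))) I"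
    by (rule indep_vars_compose2[OF indep]) (use Y in auto)
  have int1: "integrable M (\<lambda>\<omega>. exp (h * Y (X i \<omega>)))" if "i \<in> I" for i
    by (rule integrable_const_bound[where B = "exp 1"])
       (use exp_bd rv[OF that] Y in auto)
  have E1: "expectation (\<lambda>\<omega>. exp (h * Y (X i \<omega>))) = (\<integral>x. exp (h * Y x) \<partial>D)" if "i \<in> I" for i
    unfolding distr[OF that, symmetric]
    by (rule integral_distr[symmetric]) (use rv[OF that] Y in auto)
  have intG: "integrable M G"
    unfolding G_def by (rule indep_vars_integrable[OF fin ind int1])
  have "expectation G = (\<Prod>i\<in>I. expectation (\<lambda>\<omega>. exp (h * Y (X i \<omega>))))"
    unfolding G_def by (rule indep_vars_lebesgue_integral[OF fin ind int1])
  also have "\<dots> = (\<integral>x. exp (h * Y x) \<partial>D) ^ card I"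
    by (simp add: E1)
  also have "\<dots> \<le> exp (h * m + h\<^sup>2 * v) ^ card I"
    by (intro power_mono mgf integral_nonneg_AE) auto
  finally have EG: "expectation G \<le> exp (real (card I) * (h * m + h\<^sup>2 * v))"
    by (simp add: exp_of_nat_mult)
  define a where "a = exp (h * (real (card I) * (m + t)))"
  have "prob {\<omega> \<in> space M. real (card I) * (m + t) \<le> (\<Sum>i\<in>I. Y (X i \<omega>))}
      \<le> prob {\<omega> \<in> space M. a \<le> G \<omega>}"
  proof (rule finite_measure_mono)
    show "{\<omega> \<in> space M. a \<le> G \<omega>} \<in> sets M"
      using intG by measurable
    show "{\<omega> \<in> space M. real (card I) * (m + t) \<le> (\<Sum>i\<in>I. Y (X i \<omega>))} \<subseteq> {\<omega> \<in> space M. a \<le> G \<omega>}"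
      using lam fin by (auto simp: a_def G_def exp_sum[symmetric] sum_distrib_left[symmetric] intro!: mult_left_mono)
  qed
  also have "\<dots> \<le> expectation G / a"
    by (rule integral_Markov_inequality_measure[OF intG, of "{}"])
       (auto simp: G_def a_def intro!: prod_nonneg)
  also have "\<dots> \<le> exp (real (card I) * (h * m + h\<^sup>2 * v)) / a"
    by (intro divide_right_mono EG) (simp add: a_def)
  also have "\<dots> = exp (real (card I) * (h\<^sup>2 * v - h * t))"
    by (simp add: a_def exp_diff[symmetric] algebra_simps)
  finally show ?thesis by (simp add: m_def)
qed

text \<open>
  Finite linear combinations of the test functions inherit the deviation \<open>t\<close> multiplied by the
  \<open>\<ell>\<^sup>1\<close> norm of the coefficients, and a uniform approximation error \<open>e\<close> is paid once for the empirical mean and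
  once for the true mean.
\<close>

lemma empirical_error_transfer:
  fixes F :: "'a \<Rightarrow> complex" and \<psi> :: "'i \<Rightarrow> 'a \<Rightarrow> complex"
  assumes "prob_space D" and M: "M > 0"
    and pts: "\<And>i. i \<in> {1..M} \<Longrightarrow> xs i \<in> space D"
    and F: "F \<in> borel_measurable D"
    and I: "finite I"
    and psi: "\<And>i. i \<in> I \<Longrightarrow> \<psi> i \<in> borel_measurable D"
    and psib: "\<And>i x. i \<in> I \<Longrightarrow> norm (\<psi> i x) \<le> B"
    and approx: "\<And>y. y \<in> space D \<Longrightarrow> norm (F y - (\<Sum>i\<in>I. w i * \<psi> i y)) \<le> e"
    and weights: "(\<Sum>i\<in>I. norm (w i)) \<le> A"
    and dev: "\<And>i. i \<in> I \<Longrightarrow> norm (1 / of_nat M * (\<Sum>m\<in>{1..M}. \<psi> i (xs m)) - (\<integral>y. \<psi> i y \<partial>D)) \<le> t"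
    and t: "t \<ge> 0"
  shows "norm (1 / of_nat M * (\<Sum>m\<in>{1..M}. F (xs m)) - (\<integral>y. F y \<partial>D)) \<le> A * t + 2 * e"
proof -
  interpret D: prob_space D by fact
  let ?emp = "\<lambda>f :: 'a \<Rightarrow> complex. 1 / of_nat M * (\<Sum>m\<in>{1..M}. f (xs m))"
  define P where "P y = (\<Sum>i\<in>I. w i * \<psi> i y)" for y
  have intpsi: "integrable D (\<psi> i)" if "i \<in> I" for i
    by (rule D.integrable_const_bound[where B = B]) (use psib psi that in auto)
  have intP: "integrable D P"
    unfolding P_def by (intro Bochner_Integration.integrable_sum integrable_mult_right) (auto intro: intpsi)
  have intD: "integrable D (\<lambda>y. F y - P y)"
    by (rule D.integrable_const_bound[where B = e])
       (use approx F intP in \<open>auto simp: P_def[symmetric]\<close>)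
  have intF: "integrable D F"
    using Bochner_Integration.integrable_add[OF intD intP] by simp
  have 1: "norm ((\<integral>y. F y \<partial>D) - (\<integral>y. P y \<partial>D)) \<le> e"
  proof -
    have "norm (\<integral>y. F y - P y \<partial>D) \<le> (\<integral>y. norm (F y - P y) \<partial>D)"
      by (rule integral_norm_bound)
    also have "\<dots> \<le> (\<integral>y. e \<partial>D)"
      by (rule integral_mono) (use intD approx in \<open>auto simp: P_def[symmetric]\<close>)
    finally show ?thesis using intF intP by (simp add: D.prob_space)
  qed
  have 2: "norm (?emp F - ?emp P) \<le> e"
  proof -
    have "?emp F - ?emp P = 1 / of_nat M * (\<Sum>m\<in>{1..M}. F (xs m) - P (xs m))"
      by (simp add: sum_subtractf right_diff_distrib)
    also have "norm \<dots> \<le> 1 / real M * (\<Sum>m\<in>{1..M}. e)"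
      unfolding norm_mult
      by (intro mult_mono order_trans[OF norm_sum] sum_mono)
         (use pts approx in \<open>auto simp: P_def norm_divide intro!: sum_nonneg\<close>)
    also have "\<dots> = e" using M by simp
    finally show ?thesis .
  qed
  have 3: "norm (?emp P - (\<integral>y. P y \<partial>D)) \<le> A * t"
  proof -
    have e1: "?emp P = (\<Sum>i\<in>I. w i * ?emp (\<psi> i))"
      unfolding P_def by (subst sum.swap) (simp add: sum_distrib_left algebra_simps)
    have e2: "(\<integral>y. P y \<partial>D) = (\<Sum>i\<in>I. w i * (\<integral>y. \<psi> i y \<partial>D))"
      unfolding P_def by (subst Bochner_Integration.integral_sum) (auto intro!: integrable_mult_right intpsi)
    have "?emp P - (\<integral>y. P y \<partial>D) = (\<Sum>i\<in>I. w i * (?emp (\<psi> i) - (\<integral>y. \<psi> i y \<partial>D)))"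
      unfolding e1 e2 by (simp add: sum_subtractf right_diff_distrib)
    also have "norm \<dots> \<le> (\<Sum>i\<in>I. norm (w i) * t)"
      by (rule order_trans[OF norm_sum], rule sum_mono, unfold norm_mult, rule mult_left_mono)
         (use dev in auto)
    also have "\<dots> \<le> A * t"
      unfolding sum_distrib_right[symmetric] by (intro mult_right_mono weights t)
    finally show ?thesis .
  qed
  have "?emp F - (\<integral>y. F y \<partial>D) = (?emp F - ?emp P) + (?emp P - (\<integral>y. P y \<partial>D)) - ((\<integral>y. F y \<partial>D) - (\<integral>y. P y \<partial>D))"
    by simp
  also have "norm \<dots> \<le> e + A * t + e"
    by (intro order_trans[OF norm_triangle_ineq4] order_trans[OF norm_triangle_ineq] add_mono 1 2 3)
  finally show ?thesis by simp
qed

lemma abs_ge_iff: "t \<le> \<bar>x\<bar> \<longleftrightarrow> t \<le> x \<or> t \<le> - x" for x t :: real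
  by linarith

text \<open>
  A complex number of modulus above \<open>2 * t\<close> has real or imaginary part of modulus above \<open>t\<close>, so each
  complex test function gives rise to four one-sided real deviations. Stating the bound for an arbitrary
  subset \<open>E\<close> of the deviation event lets it apply to the event that a supremum over uncountably many
  functions is large; the measure of a set outside the sigma-algebra is 0.
\<close>

lemma (in prob_space) empirical_deviation_union_bound:
  fixes \<psi> :: "'i \<Rightarrow> 'b \<Rightarrow> complex"
  assumes indep: "indep_vars (\<lambda>_. N) X {1..n}" and n: "n > 0"
    and distr: "\<And>i. i \<in> {1..n} \<Longrightarrow> distr M N (X i) = D"
    and I: "finite I"
    and psi: "\<And>i. i \<in> I \<Longrightarrow> \<psi> i \<in> borel_measurable N"
    and bound: "\<And>i x. i \<in> I \<Longrightarrow> norm (\<psi> i x) \<le> B"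
    and var: "\<And>i. i \<in> I \<Longrightarrow> (\<integral>x. (norm (\<psi> i x))\<^sup>2 \<partial>D) \<le> v"
    and h: "0 \<le> h" "h * B \<le> 1"
    and E: "\<And>\<omega>. \<omega> \<in> E \<Longrightarrow> \<omega> \<in> space M \<and>
        (\<exists>i\<in>I. norm (1 / of_nat n * (\<Sum>m\<in>{1..n}. \<psi> i (X m \<omega>)) - (\<integral>x. \<psi> i x \<partial>D)) > 2 * t)"
  shows "prob E \<le> 4 * real (card I) * exp (real n * (h\<^sup>2 * v - h * t))"
proof -
  have rv: "X i \<in> measurable M N" if "i \<in> {1..n}" for i
    using indep that by (auto simp: indep_vars_def)
  have one: "1 \<in> {1..n}" using n by simp
  have D: "prob_space D" "sets D = sets N"
    using distr[OF one] prob_space_distr[OF rv[OF one]] by auto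
  interpret D: prob_space D by fact
  define T :: "'i \<Rightarrow> nat \<Rightarrow> 'b \<Rightarrow> real" where
    "T i s x = [Re (\<psi> i x), - Re (\<psi> i x), Im (\<psi> i x), - Im (\<psi> i x)] ! s" for i s x
  have Tn: "\<bar>T i s x\<bar> \<le> norm (\<psi> i x)" if "s < 4" for i s x
    using that abs_Re_le_cmod[of "\<psi> i x"] abs_Im_le_cmod[of "\<psi> i x"]
    by (auto simp: T_def less_Suc_eq numeral_eq_Suc)
  have Tm: "T i s \<in> borel_measurable N" if "i \<in> I" "s < 4" for i s
  proof -
    have "(\<lambda>x. Re (\<psi> i x)) \<in> borel_measurable N" "(\<lambda>x. Im (\<psi> i x)) \<in> borel_measurable N"
      using psi[OF that(1)] by simp_all
    then show ?thesis
      using that(2) unfolding T_def[abs_def] by (auto simp: less_Suc_eq numeral_eq_Suc)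
  qed
  define S where "S i s = {\<omega> \<in> space M. real (card {1..n}) * ((\<integral>x. T i s x \<partial>D) + t) \<le> (\<Sum>m\<in>{1..n}. T i s (X m \<omega>))}" for i s
  have Sprob: "prob (S i s) \<le> exp (real n * (h\<^sup>2 * v - h * t))" if i: "i \<in> I" and s: "s < 4" for i s
  proof -
    have psiD: "\<psi> i \<in> borel_measurable D" using psi[OF i] D measurable_cong_sets by blast
    have TD: "T i s \<in> borel_measurable D" using Tm[OF i s] D measurable_cong_sets by blast
    have sq: "(T i s x)\<^sup>2 \<le> (norm (\<psi> i x))\<^sup>2" for x
      using power_mono[OF Tn[OF s, of i x], of 2] by simp
    have sqB: "(norm (\<psi> i x))\<^sup>2 \<le> B\<^sup>2" for x
      using bound[OF i] by (intro power_mono) auto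
    have "(\<integral>x. (T i s x)\<^sup>2 \<partial>D) \<le> (\<integral>x. (norm (\<psi> i x))\<^sup>2 \<partial>D)"
    proof (rule integral_mono)
      show "integrable D (\<lambda>x. (norm (\<psi> i x))\<^sup>2)"
        by (rule D.integrable_const_bound[where B = "B\<^sup>2"]) (use psiD sqB in auto)
      show "integrable D (\<lambda>x. (T i s x)\<^sup>2)"
        by (rule D.integrable_const_bound[where B = "B\<^sup>2"]) (use TD order_trans[OF sq sqB] in auto)
    qed (rule sq)
    then have v: "(\<integral>x. (T i s x)\<^sup>2 \<partial>D) \<le> v" using var[OF i] by simp
    have Tb: "\<bar>T i s x\<bar> \<le> B" for x using Tn[OF s, of i x] bound[OF i, of x] by linarith
    show ?thesis
      using chernoff_variance_bound[OF indep _ distr Tm[OF i s] Tb v h, of t] by (simp add: S_def)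
  qed
  have Smeas: "S i s \<in> events" if "i \<in> I" "s < 4" for i s
    unfolding S_def using rv Tm[OF that]
    by (intro borel_measurable_le borel_measurable_sum measurable_const) (auto intro: measurable_compose)
  have sub: "E \<subseteq> (\<Union>i\<in>I. \<Union>s\<in>{..<4}. S i s)"
  proof
    fix \<omega> assume "\<omega> \<in> E"
    then obtain i where w: "\<omega> \<in> space M" and i: "i \<in> I"
      and gt: "norm (1 / of_nat n * (\<Sum>m\<in>{1..n}. \<psi> i (X m \<omega>)) - (\<integral>x. \<psi> i x \<partial>D)) > 2 * t"
      using E by blast
    let ?Z = "1 / of_nat n * (\<Sum>m\<in>{1..n}. \<psi> i (X m \<omega>)) - (\<integral>x. \<psi> i x \<partial>D)"
    have psiD: "\<psi> i \<in> borel_measurable D" using psi[OF i] D measurable_cong_sets by blast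
    have intpsi: "integrable D (\<psi> i)"
      by (rule D.integrable_const_bound[where B = B]) (use bound i psiD in auto)
    have "2 * t < \<bar>Re ?Z\<bar> + \<bar>Im ?Z\<bar>"
      using gt cmod_le[of ?Z] by linarith
    then have "t \<le> \<bar>Re ?Z\<bar> \<or> t \<le> \<bar>Im ?Z\<bar>" by linarith
    moreover have "Re ?Z = 1 / real n * (\<Sum>m\<in>{1..n}. Re (\<psi> i (X m \<omega>))) - (\<integral>x. Re (\<psi> i x) \<partial>D)"
      using intpsi by (simp add: Re_divide_of_nat)
    moreover have "Im ?Z = 1 / real n * (\<Sum>m\<in>{1..n}. Im (\<psi> i (X m \<omega>))) - (\<integral>x. Im (\<psi> i x) \<partial>D)"
      using intpsi by (simp add: Im_divide_of_nat)
    ultimately have "t \<le> \<bar>1 / real n * (\<Sum>m\<in>{1..n}. Re (\<psi> i (X m \<omega>))) - (\<integral>x. Re (\<psi> i x) \<partial>D)\<bar>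
        \<or> t \<le> \<bar>1 / real n * (\<Sum>m\<in>{1..n}. Im (\<psi> i (X m \<omega>))) - (\<integral>x. Im (\<psi> i x) \<partial>D)\<bar>"
      by (simp only:)
    then consider "t \<le> 1 / real n * (\<Sum>m\<in>{1..n}. Re (\<psi> i (X m \<omega>))) - (\<integral>x. Re (\<psi> i x) \<partial>D)"
      | "t \<le> - (1 / real n * (\<Sum>m\<in>{1..n}. Re (\<psi> i (X m \<omega>))) - (\<integral>x. Re (\<psi> i x) \<partial>D))"
      | "t \<le> 1 / real n * (\<Sum>m\<in>{1..n}. Im (\<psi> i (X m \<omega>))) - (\<integral>x. Im (\<psi> i x) \<partial>D)"
      | "t \<le> - (1 / real n * (\<Sum>m\<in>{1..n}. Im (\<psi> i (X m \<omega>))) - (\<integral>x. Im (\<psi> i x) \<partial>D))"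
      unfolding abs_ge_iff by blast
    \<comment> \<open>The index \<open>s\<close> names which of the four one-sided real deviations occurs.\<close>
    then obtain s where s: "s < 4" and le: "t \<le> 1 / real n * (\<Sum>m\<in>{1..n}. T i s (X m \<omega>)) - (\<integral>x. T i s x \<partial>D)"
    proof cases
      case 1
      then show ?thesis by (intro that[of 0]) (simp_all add: T_def[abs_def])
    next
      case 2
      then show ?thesis by (intro that[of 1]) (simp_all add: T_def[abs_def] sum_negf)
    next
      case 3
      then show ?thesis by (intro that[of 2]) (simp_all add: T_def[abs_def])
    next
      case 4
      then show ?thesis by (intro that[of 3]) (simp_all add: T_def[abs_def] sum_negf)
    qed
    then have "\<omega> \<in> S i s" using w n by (simp add: S_def field_simps)
    then show "\<omega> \<in> (\<Union>i\<in>I. \<Union>s\<in>{..<4}. S i s)" using i s by blast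
  qed
  have "prob E \<le> prob (\<Union>i\<in>I. \<Union>s\<in>{..<4}. S i s)"
    by (rule finite_measure_mono[OF sub]) (use I Smeas in \<open>auto intro!: sets.finite_UN\<close>)
  also have "\<dots> \<le> (\<Sum>i\<in>I. prob (\<Union>s\<in>{..<4}. S i s))"
    by (rule finite_measure_subadditive_finite) (use I Smeas in \<open>auto intro!: sets.finite_UN\<close>)
  also have "\<dots> \<le> (\<Sum>i\<in>I. \<Sum>s\<in>{..<4}. prob (S i s))"
    by (intro sum_mono finite_measure_subadditive_finite) (use Smeas in auto)
  also have "\<dots> \<le> (\<Sum>i\<in>I. \<Sum>s\<in>{..<4 :: nat}. exp (real n * (h\<^sup>2 * v - h * t)))"
    by (intro sum_mono Sprob) auto
  finally show ?thesis by simp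
qed

section \<open>A discrete Cauchy formula in several variables\<close>

definition root_of_unity :: "nat \<Rightarrow> nat \<Rightarrow> complex" where
  "root_of_unity N l = cis (2 * pi * real l / real N)"

text \<open>
  The truncated Cauchy kernel: \<open>1 / (1 - s)\<close> cut off after \<open>N\<close> terms, so that discretised Cauchy
  integrals reproduce polynomials of degree below \<open>N\<close> exactly.
\<close>

definition geom_poly :: "nat \<Rightarrow> complex \<Rightarrow> complex" where
  "geom_poly N s = (\<Sum>k<N. s ^ k)"

lemma norm_root_of_unity [simp]: "norm (root_of_unity N l) = 1"
  by (simp add: root_of_unity_def)

lemma root_of_unity_nonzero [simp]: "root_of_unity N l \<noteq> 0"
  by (simp add: root_of_unity_def)

lemma norm_geom_poly_le_2:
  assumes "norm s \<le> 1 / 2"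
  shows "norm (geom_poly N s) \<le> 2"
proof -
  have "norm (geom_poly N s) \<le> (\<Sum>k<N. (1 / 2) ^ k)"
    unfolding geom_poly_def
    by (rule order_trans[OF norm_sum]) (use assms in \<open>auto intro!: sum_mono power_mono simp: norm_power\<close>)
  also have "\<dots> = 2 - 2 * (1 / 2) ^ N" by (simp add: geometric_sum)
  also have "\<dots> \<le> 2" by simp
  finally show ?thesis .
qed

lemma root_of_unity_orthogonality:
  assumes "m < N" "k < N"
  shows "(\<Sum>l<N. root_of_unity N l ^ m / root_of_unity N l ^ k) = (if m = k then of_nat N else 0)"
proof (cases "m = k")
  case False
  define z where "z = cis (2 * pi * (real m - real k) / real N)"
  have N: "N > 0" using assms by simp
  have trm: "root_of_unity N l ^ m / root_of_unity N l ^ k = z ^ l" for l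
    unfolding root_of_unity_def z_def Complex.DeMoivre cis_divide
    by (rule arg_cong[where f = cis]) (simp add: diff_divide_distrib algebra_simps)
  have "z \<noteq> 1"
  proof
    assume "z = 1"
    then have "cos (2 * pi * (real m - real k) / real N) = 1"
      by (auto simp: z_def complex_eq_iff)
    then obtain a :: int where "2 * pi * (real m - real k) / real N = of_int a * 2 * pi"
      using cos_one_2pi_int by blast
    then have "2 * pi * (real m - real k) = 2 * pi * (of_int a * real N)" using N by (simp add: field_simps)
    then have "real m - real k = of_int a * real N" by (subst (asm) mult_left_cancel) auto
    then have "real_of_int (int m - int k) = real_of_int (a * int N)" by simp
    then have eq: "int m - int k = a * int N" by linarith
    have "\<bar>int m - int k\<bar> < int N" using assms by linarith
    then have "\<bar>a\<bar> * int N < 1 * int N" unfolding eq by (simp add: abs_mult)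
    then have "a = 0" using N by auto
    with eq False show False by simp
  qed
  moreover have "z ^ N = 1"
  proof -
    have "z ^ N = cis (2 * pi * of_int (int m - int k))"
      unfolding z_def Complex.DeMoivre
      by (rule arg_cong[where f = cis]) (use N in \<open>simp add: field_simps\<close>)
    also have "\<dots> = 1" by (rule cis_multiple_2pi) auto
    finally show ?thesis .
  qed
  ultimately show ?thesis using False unfolding trm by (simp add: geometric_sum)
qed simp

text \<open>
  Expanding the kernel and the polynomial turns the sum over the nodes into the orthogonality relation
  of the characters of the cyclic group, which picks out \<open>k = m\<close> because both exponents lie below \<open>N\<close>.
\<close>

lemma discrete_cauchy_exact:
  assumes "r > 0" "N > 0"
  shows "(1 / of_nat N) * (\<Sum>l<N. (\<Sum>m<N. c m * (of_real r * root_of_unity N l) ^ m)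
            * geom_poly N (u / (of_real r * root_of_unity N l))) = (\<Sum>m<N. c m * u ^ m)"
proof -
  let ?w = "root_of_unity N"
  have "(\<Sum>l<N. (\<Sum>m<N. c m * (of_real r * ?w l) ^ m) * geom_poly N (u / (of_real r * ?w l)))
      = (\<Sum>l<N. \<Sum>m<N. \<Sum>k<N. c m * of_real r ^ m * (u / of_real r) ^ k * (?w l ^ m / ?w l ^ k))"
    unfolding geom_poly_def sum_product
    by (intro sum.cong refl) (simp add: power_mult_distrib power_divide)
  also have "\<dots> = (\<Sum>m<N. \<Sum>k<N. \<Sum>l<N. c m * of_real r ^ m * (u / of_real r) ^ k * (?w l ^ m / ?w l ^ k))"
    by (rule trans[OF sum.swap], rule sum.cong[OF refl], rule sum.swap)
  also have "\<dots> = (\<Sum>m<N. \<Sum>k<N. c m * of_real r ^ m * (u / of_real r) ^ k * (if m = k then of_nat N else 0))"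
    by (intro sum.cong refl) (simp only: sum_distrib_left[symmetric] root_of_unity_orthogonality lessThan_iff)
  also have "\<dots> = (\<Sum>m<N. of_nat N * (c m * u ^ m))"
  proof (rule sum.cong[OF refl])
    fix m assume "m \<in> {..<N}"
    have "(\<Sum>k<N. c m * of_real r ^ m * (u / of_real r) ^ k * (if m = k then of_nat N else 0))
        = (\<Sum>k<N. if k = m then c m * of_real r ^ m * (u / of_real r) ^ m * of_nat N else 0)"
      by (intro sum.cong) auto
    also have "\<dots> = of_nat N * (c m * u ^ m)"
      using \<open>m \<in> {..<N}\<close> assms by (simp add: power_divide)
    finally show "(\<Sum>k<N. c m * of_real r ^ m * (u / of_real r) ^ k * (if m = k then of_nat N else 0))
        = of_nat N * (c m * u ^ m)" .
  qed
  also have "\<dots> = of_nat N * (\<Sum>m<N. c m * u ^ m)" by (simp add: sum_distrib_left)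
  finally show ?thesis using assms by simp
qed

text \<open>
  Split \<open>g\<close> into its Taylor polynomial of degree below \<open>N\<close>, which the formula reproduces, and a tail.
  Cauchy's estimates on the circle of radius \<open>2 * r\<close> bound the tail by \<open>2 * B / 2 ^ N\<close> on the disc of radius
  \<open>r\<close>, which contains both \<open>u\<close> and the nodes. The formula at most doubles the tail, because its kernel is
  bounded by 2 when \<open>norm u \<le> r / 2\<close>.
\<close>

lemma discrete_cauchy_one_variable:
  fixes g :: "complex \<Rightarrow> complex"
  assumes r: "r > 0" and N: "N > 0"
    and hol: "\<And>w. norm w \<le> 2 * r \<Longrightarrow> g field_differentiable at w"
    and bound: "\<And>w. norm w \<le> 2 * r \<Longrightarrow> norm (g w) \<le> B"
    and u: "norm u \<le> r / 2"
  shows "norm (g u - (1 / of_nat N) * (\<Sum>l<N. g (of_real r * root_of_unity N l)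
                 * geom_poly N (u / (of_real r * root_of_unity N l)))) \<le> 6 * B / 2 ^ N"
proof -
  let ?p = "\<lambda>l. of_real r * root_of_unity N l"
  define c where "c m = (deriv ^^ m) g 0 / fact m" for m
  define T where "T w = (\<Sum>m<N. c m * w ^ m)" for w
  have B0: "0 \<le> B" using bound[of 0] r by (smt (verit) norm_ge_zero norm_zero)
  have holb: "g holomorphic_on ball 0 (2 * r)"
    unfolding holomorphic_on_def by (auto intro!: field_differentiable_at_within hol)
  have cont: "continuous_on (cball 0 (2 * r)) g"
    by (auto intro!: continuous_at_imp_continuous_on field_differentiable_imp_continuous_at hol)
  have coeff: "norm (c m) \<le> B / (2 * r) ^ m" for m
  proof -
    have "norm ((deriv ^^ m) g 0) \<le> fact m * B / (2 * r) ^ m"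
      by (rule Cauchy_inequality[OF holb cont]) (use r bound in auto)
    then have "norm ((deriv ^^ m) g 0) / fact m \<le> (fact m * B / (2 * r) ^ m) / fact m"
      by (rule divide_right_mono) simp
    then show ?thesis by (simp add: c_def norm_divide)
  qed
  have tail: "norm (g w - T w) \<le> 2 * B / 2 ^ N" if w: "norm w \<le> r" for w
  proof -
    have sums: "(\<lambda>m. c m * w ^ m) sums g w"
      using holomorphic_power_series[OF holb, of w] w r by (simp add: c_def)
    have trm: "norm (c m * w ^ m) \<le> B * (1 / 2) ^ m" for m
    proof -
      have "norm (c m * w ^ m) \<le> B / (2 * r) ^ m * r ^ m"
        unfolding norm_mult norm_power
        by (intro mult_mono coeff power_mono w) (use B0 r in auto)
      also have "\<dots> = B * (1 / 2) ^ m" using r by (simp add: power_mult_distrib power_divide)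
      finally show ?thesis .
    qed
    have "(\<lambda>m. c (m + N) * w ^ (m + N)) sums (g w - T w)"
      using sums_split_initial_segment[OF sums, of N] by (simp add: T_def)
    moreover have "(\<lambda>m. B / 2 ^ N * (1 / 2) ^ m) sums (B / 2 ^ N * (1 / (1 - 1 / 2)))"
      by (intro sums_mult geometric_sums) auto
    moreover have "norm (c (m + N) * w ^ (m + N)) \<le> B / 2 ^ N * (1 / 2) ^ m" for m
      using trm[of "m + N"] by (simp add: power_add power_divide mult.commute)
    ultimately have "norm (g w - T w) \<le> B / 2 ^ N * (1 / (1 - 1 / 2))"
      by (metis (no_types, lifting) norm_suminf_le sums_iff)
    then show ?thesis by (simp add: mult.commute)
  qed
  have pn: "norm (?p l) = r" for l using r by (simp add: norm_mult)
  have "(1 / of_nat N) * (\<Sum>l<N. g (?p l) * geom_poly N (u / ?p l)) - T u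
      = (1 / of_nat N) * (\<Sum>l<N. (g (?p l) - T (?p l)) * geom_poly N (u / ?p l))"
    using discrete_cauchy_exact[OF r N, of c u]
    by (simp add: T_def sum_subtractf algebra_simps)
  also have "norm \<dots> \<le> (1 / real N) * (\<Sum>l<N. 2 * B / 2 ^ N * 2)"
    unfolding norm_mult
  proof (intro mult_mono order_trans[OF norm_sum] sum_mono)
    fix l assume "l \<in> {..<N}"
    have "norm (u / ?p l) \<le> 1 / 2"
      using u r unfolding norm_divide pn by (simp add: field_simps)
    then show "norm ((g (?p l) - T (?p l)) * geom_poly N (u / ?p l)) \<le> 2 * B / 2 ^ N * 2"
      unfolding norm_mult using B0 pn by (intro mult_mono tail norm_geom_poly_le_2) auto
  qed (auto simp: norm_divide intro!: sum_nonneg B0)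
  also have "\<dots> = 4 * B / 2 ^ N" using N by simp
  finally have "norm ((1 / of_nat N) * (\<Sum>l<N. g (?p l) * geom_poly N (u / ?p l)) - T u) \<le> 4 * B / 2 ^ N" .
  moreover have "norm (g u - T u) \<le> 2 * B / 2 ^ N"
    using u r by (intro tail) auto
  ultimately show ?thesis
    by (smt (verit, ccfv_SIG) add_divide_distrib norm_minus_commute norm_diff_triangle_le)
qed

text \<open>
  Only the coordinates in \<open>S\<close> are moved to nodes. The partial versions are the intermediate stages of an
  induction that discretises one coordinate at a time.
\<close>

definition interp_node ::
  "nat \<Rightarrow> real \<Rightarrow> complex^'n \<Rightarrow> 'n set \<Rightarrow> ('n \<Rightarrow> nat) \<Rightarrow> complex^'n \<Rightarrow> complex^'n" where
  "interp_node N r q S l z =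
     (\<chi> i. if i \<in> S then q $ i + of_real r * root_of_unity N (l i) else z $ i)"

definition interp_weight :: "nat \<Rightarrow> real \<Rightarrow> complex^'n \<Rightarrow> 'n set \<Rightarrow> ('n \<Rightarrow> nat) \<Rightarrow> complex^'n \<Rightarrow> complex" where
  "interp_weight N r q S l z = (\<Prod>i\<in>S. geom_poly N ((z $ i - q $ i) / (of_real r * root_of_unity N (l i))))"

lemma norm_interp_weight:
  assumes "r > 0" "\<And>i. i \<in> S \<Longrightarrow> norm (z $ i - q $ i) \<le> r / 2"
  shows "norm (interp_weight N r q S l z) \<le> 2 ^ card S"
proof -
  have "norm (interp_weight N r q S l z) \<le> (\<Prod>i\<in>S. 2)"
    unfolding interp_weight_def prod_norm[symmetric]
  proof (intro prod_mono conjI norm_geom_poly_le_2)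
    fix i assume "i \<in> S"
    then show "norm ((z $ i - q $ i) / (of_real r * root_of_unity N (l i))) \<le> 1 / 2"
      using assms by (simp add: norm_divide norm_mult field_simps)
  qed auto
  then show ?thesis by simp
qed

text \<open>
  The coordinates are discretised one after another. The coefficients are plain values of \<open>f\<close>, so no
  analyticity in the remaining variables is lost along the way. A new coordinate adds the one-variable
  error and doubles the error made before, whence the factor \<open>2 ^ card S - 1\<close>.
\<close>

lemma discrete_cauchy_several_variables:
  fixes f :: "complex^'n \<Rightarrow> complex" and q :: "complex^'n"
  assumes r: "r > 0" and N: "N > 0"
    and hol: "\<And>z i. (\<And>j. norm (z $ j - q $ j) \<le> 2 * r) \<Longrightarrow>
               (\<lambda>w. f (\<chi> j. if j = i then w else z $ j)) field_differentiable at (z $ i)"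
    and bound: "\<And>z. (\<And>j. norm (z $ j - q $ j) \<le> 2 * r) \<Longrightarrow> norm (f z) \<le> B"
    and "finite S"
    and "\<And>j. norm (z $ j - q $ j) \<le> r" "\<And>j. j \<in> S \<Longrightarrow> norm (z $ j - q $ j) \<le> r / 2"
  shows "norm (f z - (1 / of_nat N) ^ card S * (\<Sum>l\<in>PiE S (\<lambda>_. {..<N}).
           f (interp_node N r q S l z) * interp_weight N r q S l z)) \<le> (2 ^ card S - 1) * (6 * B / 2 ^ N)"
  using assms(5-)
proof (induction S arbitrary: z rule: finite_induct)
  case empty
  have "interp_node N r q {} l z = z" for l by (simp add: interp_node_def vec_eq_iff)
  then show ?case by (simp add: interp_weight_def)
next
  case (insert i S)
  let ?e = "6 * B / 2 ^ N"
  define z' where "z' k = (\<chi> j. if j = i then q $ i + of_real r * root_of_unity N k else z $ j)" for k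
  define A where "A y = (1 / of_nat N) ^ card S * (\<Sum>l\<in>PiE S (\<lambda>_. {..<N}).
           f (interp_node N r q S l y) * interp_weight N r q S l y)" for y
  define G where "G k = geom_poly N ((z $ i - q $ i) / (of_real r * root_of_unity N k))" for k
  have zi: "norm (z $ i - q $ i) \<le> r / 2" using insert.prems by simp
  have near: "norm (z' k $ j - q $ j) \<le> r" for k j
    using insert.prems(1)[of j] r by (auto simp: z'_def norm_mult)
  have IH: "norm (f (z' k) - A (z' k)) \<le> (2 ^ card S - 1) * ?e" for k
    unfolding A_def
  proof (rule insert.IH[OF near])
    fix j assume j: "j \<in> S"
    then have "j \<noteq> i" using insert.hyps by auto
    then show "norm (z' k $ j - q $ j) \<le> r / 2" using insert.prems(2)[of j] j by (simp add: z'_def)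
  qed
  have G2: "norm (G k) \<le> 2" for k
    unfolding G_def using zi r by (intro norm_geom_poly_le_2) (simp add: norm_divide norm_mult field_simps)
  \<comment> \<open>The new coordinate is discretised first, at the given point \<open>z\<close>.\<close>
  have one: "norm (f z - (1 / of_nat N) * (\<Sum>k<N. f (z' k) * G k)) \<le> ?e"
  proof -
    define g where "g w = f (\<chi> j. if j = i then q $ i + w else z $ j)" for w
    have "norm (g (z $ i - q $ i) - (1 / of_nat N) * (\<Sum>l<N. g (of_real r * root_of_unity N l)
                 * geom_poly N ((z $ i - q $ i) / (of_real r * root_of_unity N l)))) \<le> ?e"
    proof (rule discrete_cauchy_one_variable[OF r N _ _ zi])
      fix w :: complex assume w: "norm w \<le> 2 * r"
      define y where "y = (\<chi> j. if j = i then q $ i + w else z $ j)"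
      have y: "norm (y $ j - q $ j) \<le> 2 * r" for j
        using w insert.prems(1)[of j] r by (auto simp: y_def)
      show "norm (g w) \<le> B" unfolding g_def y_def[symmetric] by (rule bound[OF y])
      have "(\<lambda>w. f (\<chi> j. if j = i then w else y $ j)) field_differentiable at (q $ i + w)"
        using hol[OF y, of i] by (simp add: y_def)
      moreover have "(\<lambda>w. q $ i + w) field_differentiable at w"
        by (intro derivative_intros)
      ultimately have "((\<lambda>w. f (\<chi> j. if j = i then w else y $ j)) \<circ> (\<lambda>w. q $ i + w)) field_differentiable at w"
        by (intro field_differentiable_compose) auto
      moreover have "(\<chi> j. if j = i then v else y $ j) = (\<chi> j. if j = i then v else z $ j)" for v
        by (simp add: vec_eq_iff y_def)
      ultimately show "g field_differentiable at w"
        unfolding g_def comp_def by simp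
    qed
    moreover have "(\<chi> j. if j = i then q $ i + (z $ i - q $ i) else z $ j) = z"
      by (simp add: vec_eq_iff)
    ultimately show ?thesis by (simp only: g_def G_def z'_def)
  qed
  have split: "(\<Sum>l\<in>PiE (insert i S) (\<lambda>_. {..<N}). F l) = (\<Sum>k<N. \<Sum>l\<in>PiE S (\<lambda>_. {..<N}). F (l(i := k)))"
    for F :: "('n \<Rightarrow> nat) \<Rightarrow> complex"
    unfolding PiE_insert_eq using insert.hyps
    by (subst sum.reindex[OF inj_combinator]) (auto simp: sum.cartesian_product case_prod_beta)
  have node: "interp_node N r q (insert i S) (l(i := k)) z = interp_node N r q S l (z' k)" for l k
    using insert.hyps by (auto simp: interp_node_def vec_eq_iff z'_def)
  have weight: "interp_weight N r q (insert i S) (l(i := k)) z = G k * interp_weight N r q S l (z' k)" for l k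
  proof -
    have "interp_weight N r q S (l(i := k)) z = interp_weight N r q S l (z' k)"
      unfolding interp_weight_def by (rule prod.cong) (use insert.hyps in \<open>auto simp: z'_def\<close>)
    then show ?thesis
      unfolding interp_weight_def using insert.hyps by (simp add: G_def)
  qed
  have full: "(1 / of_nat N) ^ card (insert i S) * (\<Sum>l\<in>PiE (insert i S) (\<lambda>_. {..<N}).
           f (interp_node N r q (insert i S) l z) * interp_weight N r q (insert i S) l z)
      = (1 / of_nat N) * (\<Sum>k<N. A (z' k) * G k)"
    unfolding split node weight A_def using insert.hyps
    by (simp add: sum_distrib_left sum_distrib_right algebra_simps)
  have "(1 / of_nat N) * (\<Sum>k<N. f (z' k) * G k) - (1 / of_nat N) * (\<Sum>k<N. A (z' k) * G k)
      = (1 / of_nat N) * (\<Sum>k<N. (f (z' k) - A (z' k)) * G k)"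
    by (simp add: sum_subtractf algebra_simps)
  also have "norm \<dots> \<le> (1 / real N) * (\<Sum>k<N. (2 ^ card S - 1) * ?e * 2)"
    unfolding norm_mult
  proof (intro mult_mono order_trans[OF norm_sum] sum_mono)
    fix k
    have "norm (f (z' k) - A (z' k)) * norm (G k) \<le> (2 ^ card S - 1) * ?e * 2"
      by (rule mult_mono[OF IH G2]) (use order_trans[OF norm_ge_zero IH] in auto)
    then show "norm ((f (z' k) - A (z' k)) * G k) \<le> (2 ^ card S - 1) * ?e * 2"
      by (simp add: norm_mult)
  qed (auto simp: norm_divide intro!: sum_nonneg)
  also have "\<dots> = (2 * 2 ^ card S - 2) * ?e" using N by (simp add: algebra_simps diff_divide_distrib)
  finally have two: "norm ((1 / of_nat N) * (\<Sum>k<N. f (z' k) * G k) - (1 / of_nat N) * (\<Sum>k<N. A (z' k) * G k))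
      \<le> (2 * 2 ^ card S - 2) * ?e" .
  have "norm (f z - (1 / of_nat N) * (\<Sum>k<N. A (z' k) * G k)) \<le> ?e + (2 * 2 ^ card S - 2) * ?e"
    using norm_diff_triangle_le[OF one two] .
  also have "\<dots> = (2 ^ card (insert i S) - 1) * ?e"
    using insert.hyps by (simp add: algebra_simps diff_divide_distrib)
  finally show ?case unfolding full .
qed

lemma has_sum_finite_sum:
  fixes f :: "'i \<Rightarrow> 'j \<Rightarrow> 'a :: {topological_comm_monoid_add, t2_space}"
  assumes "finite I" "\<And>i. i \<in> I \<Longrightarrow> (f i has_sum s i) A"
  shows "((\<lambda>x. \<Sum>i\<in>I. f i x) has_sum (\<Sum>i\<in>I. s i)) A"
  using assms
proof (induction I rule: finite_induct)
  case empty
  then show ?case by (simp add: has_sum_0)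
next
  case (insert i I)
  then show ?case using has_sum_add[of "f i" A "s i" "\<lambda>x. \<Sum>i\<in>I. f i x" "\<Sum>i\<in>I. s i"] by simp
qed

lemma has_sum_diff:
  fixes f g :: "'j \<Rightarrow> 'a :: real_normed_vector"
  assumes "(f has_sum a) A" "(g has_sum b) A"
  shows "((\<lambda>x. f x - g x) has_sum (a - b)) A"
proof -
  have "((\<lambda>x. - g x) has_sum - b) A" using assms(2) by (simp add: has_sum_uminus)
  from has_sum_add[OF assms(1) this] show ?thesis by simp
qed

text \<open>
  The formula is linear in the function, so it can be summed over a series with a summable bound.
  In this way the periodised kernel is treated term by term, from estimates for single Gaussians.
\<close>

lemma discrete_cauchy_series:
  fixes F :: "'j \<Rightarrow> complex^'n \<Rightarrow> complex" and q :: "complex^'n"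
  assumes r: "r > 0" and N: "N > 0" and b: "b summable_on UNIV"
    and hol: "\<And>\<iota> z i. (\<And>j. norm (z $ j - q $ j) \<le> 2 * r) \<Longrightarrow>
               (\<lambda>w. F \<iota> (\<chi> j. if j = i then w else z $ j)) field_differentiable at (z $ i)"
    and bound: "\<And>\<iota> z. (\<And>j. norm (z $ j - q $ j) \<le> 2 * r) \<Longrightarrow> norm (F \<iota> z) \<le> b \<iota>"
  defines "W \<equiv> \<lambda>l. \<Sum>\<^sub>\<infinity>\<iota>. F \<iota> (interp_node N r q UNIV l q)"
  shows "norm (W l) \<le> infsum b UNIV"
    and "(\<And>j. norm (z $ j - q $ j) \<le> r / 2) \<Longrightarrow>
          norm ((\<Sum>\<^sub>\<infinity>\<iota>. F \<iota> z) - (1 / of_nat N) ^ CARD('n) * (\<Sum>l\<in>PiE UNIV (\<lambda>_. {..<N}). W l * interp_weight N r q UNIV l z))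
          \<le> 2 ^ CARD('n) * 6 / 2 ^ N * infsum b UNIV"
proof -
  let ?L = "PiE UNIV (\<lambda>_ :: 'n. {..<N})"
  let ?n = "\<lambda>l. interp_node N r q UNIV l q"
  have summ: "(\<lambda>\<iota>. norm (F \<iota> z)) summable_on UNIV" if "\<And>j. norm (z $ j - q $ j) \<le> 2 * r" for z
  proof (rule summable_on_comparison_test[OF b])
    show "norm (F \<iota> z) \<le> b \<iota>" for \<iota> by (rule bound, rule that)
  qed auto
  have node: "norm (?n l $ j - q $ j) \<le> 2 * r" for l j
    using r by (simp add: interp_node_def norm_mult)
  show "norm (W l) \<le> infsum b UNIV"
    unfolding W_def
  proof (rule norm_infsum_le[OF has_sum_infsum has_sum_infsum[OF b]])
    show "(\<lambda>\<iota>. F \<iota> (?n l)) summable_on UNIV"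
      by (rule Infinite_Sum.abs_summable_summable, rule summ, rule node)
    show "norm (F \<iota> (?n l)) \<le> b \<iota>" for \<iota> by (rule bound, rule node)
  qed
  assume z: "\<And>j. norm (z $ j - q $ j) \<le> r / 2"
  have z2: "norm (z $ j - q $ j) \<le> 2 * r" for j using z[of j] r by simp
  define R where "R \<iota> = F \<iota> z - (1 / of_nat N) ^ CARD('n) * (\<Sum>l\<in>?L. F \<iota> (?n l) * interp_weight N r q UNIV l z)" for \<iota>
  have s1: "((\<lambda>\<iota>. F \<iota> z) has_sum (\<Sum>\<^sub>\<infinity>\<iota>. F \<iota> z)) UNIV"
    by (rule has_sum_infsum, rule Infinite_Sum.abs_summable_summable, rule summ, rule z2)
  have s2: "((\<lambda>\<iota>. F \<iota> (?n l)) has_sum W l) UNIV" for l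
    unfolding W_def by (rule has_sum_infsum, rule Infinite_Sum.abs_summable_summable, rule summ, rule node)
  have sR: "(R has_sum ((\<Sum>\<^sub>\<infinity>\<iota>. F \<iota> z) - (1 / of_nat N) ^ CARD('n) * (\<Sum>l\<in>?L. W l * interp_weight N r q UNIV l z))) UNIV"
    unfolding R_def
    by (rule has_sum_diff[OF s1], rule has_sum_cmult_right, rule has_sum_finite_sum,
        simp add: finite_PiE, rule has_sum_cmult_left, rule s2)
  have nodez: "interp_node N r q UNIV l z = ?n l" for l
    by (simp add: interp_node_def)
  have Rb: "norm (R \<iota>) \<le> 2 ^ CARD('n) * 6 / 2 ^ N * b \<iota>" for \<iota>
  proof -
    have "norm (F \<iota> q) \<le> b \<iota>" by (rule bound) (use r in simp)
    then have b0: "0 \<le> b \<iota>" using norm_ge_zero order_trans by blast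
    have z1: "norm (z $ j - q $ j) \<le> r" for j using z[of j] r by simp
    have "norm (R \<iota>) \<le> (2 ^ CARD('n) - 1) * (6 * b \<iota> / 2 ^ N)"
      unfolding R_def nodez[symmetric]
      by (rule discrete_cauchy_several_variables[OF r N hol bound finite z1 z])
    also have "\<dots> \<le> 2 ^ CARD('n) * (6 * b \<iota> / 2 ^ N)"
      using b0 by (intro mult_right_mono) auto
    finally show ?thesis by (simp add: mult.assoc)
  qed
  show "norm ((\<Sum>\<^sub>\<infinity>\<iota>. F \<iota> z) - (1 / of_nat N) ^ CARD('n) * (\<Sum>l\<in>?L. W l * interp_weight N r q UNIV l z))
          \<le> 2 ^ CARD('n) * 6 / 2 ^ N * infsum b UNIV"
    by (rule norm_infsum_le[OF sR has_sum_cmult_right[OF has_sum_infsum[OF b]]]) (rule Rb)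
qed

section \<open>Gaussian sums over lattices\<close>

definition lattice_point :: "int^'n \<Rightarrow> real^'n" where
  "lattice_point j = (\<chi> i. of_int (j $ i))"

lemma norm_power2_vec: "(norm (x :: real^'n))\<^sup>2 = (\<Sum>i\<in>UNIV. (x $ i)\<^sup>2)"
  by (simp add: norm_vec_def L2_set_def sum_nonneg)

lemma summable_gauss_int:
  fixes a :: real
  assumes "a > 0"
  shows "(\<lambda>k :: int. exp (- (a * (real_of_int k)\<^sup>2))) summable_on UNIV"
proof (rule summable_on_comparison_test)
  have geo: "(\<lambda>n :: nat. exp (- a) ^ n) summable_on UNIV"
    using assms by (intro norm_summable_imp_summable_on) (auto simp: summable_geometric)
  have "(\<lambda>k :: int. exp (- a) ^ nat \<bar>k\<bar>) summable_on range int \<union> range (\<lambda>n. - int n)"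
  proof (rule summable_on_union)
    show "(\<lambda>k :: int. exp (- a) ^ nat \<bar>k\<bar>) summable_on range int"
      using geo by (subst summable_on_reindex) (auto simp: comp_def)
    show "(\<lambda>k :: int. exp (- a) ^ nat \<bar>k\<bar>) summable_on range (\<lambda>n. - int n)"
      using geo by (subst summable_on_reindex) (auto simp: comp_def inj_on_def)
  qed
  moreover have "range int \<union> range (\<lambda>n. - int n) = UNIV"
  proof -
    have "k \<in> range int \<union> range (\<lambda>n. - int n)" for k
      by (cases k rule: int_cases2) auto
    then show ?thesis by blast
  qed
  ultimately show "(\<lambda>k :: int. exp (- a) ^ nat \<bar>k\<bar>) summable_on UNIV" by simp
  fix k :: int
  have "\<bar>k\<bar> \<le> k\<^sup>2" using self_le_power[of "\<bar>k\<bar>" 2] by (cases "k = 0") auto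
  then have "real_of_int \<bar>k\<bar> \<le> (real_of_int k)\<^sup>2"
    by (metis of_int_le_iff of_int_power)
  then have "exp (- (a * (real_of_int k)\<^sup>2)) \<le> exp (- (a * real_of_int \<bar>k\<bar>))"
    using assms by simp
  also have "\<dots> = exp (- a) ^ nat \<bar>k\<bar>"
    by (simp add: exp_of_nat_mult[symmetric] mult.commute)
  finally show "exp (- (a * (real_of_int k)\<^sup>2)) \<le> exp (- a) ^ nat \<bar>k\<bar>" .
qed auto

text \<open>
  A finite set of lattice points lies in a cube, over which the sum factors into one-dimensional sums.
\<close>

lemma lattice_gauss_sum_centered:
  fixes a :: real
  assumes a: "a > 0" and F: "finite (F :: (int^'n) set)"
  shows "(\<Sum>j\<in>F. exp (- (a * (norm (lattice_point j))\<^sup>2)))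
           \<le> (\<Sum>\<^sub>\<infinity>k\<in>(UNIV :: int set). exp (- (a * (real_of_int k)\<^sup>2))) ^ CARD('n)"
proof -
  let ?e = "\<lambda>k :: int. exp (- (a * (real_of_int k)\<^sup>2))"
  define A where "A = (\<Union>i. (\<lambda>j. j $ i) ` F)"
  have A: "finite A" unfolding A_def using F by auto
  have "(\<Sum>j\<in>F. exp (- (a * (norm (lattice_point j))\<^sup>2))) = (\<Sum>j\<in>F. \<Prod>i\<in>UNIV. ?e (j $ i))"
    by (intro sum.cong refl)
       (simp add: norm_power2_vec lattice_point_def exp_sum[symmetric] sum_distrib_left sum_negf[symmetric])
  also have "\<dots> = (\<Sum>g\<in>vec_nth ` F. \<Prod>i\<in>UNIV. ?e (g i))"
    by (subst sum.reindex) (auto simp: inj_on_def vec_eq_iff fun_eq_iff)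
  also have "\<dots> \<le> (\<Sum>g\<in>PiE (UNIV :: 'n set) (\<lambda>_. A). \<Prod>i\<in>UNIV. ?e (g i))"
  proof (rule sum_mono2)
    show "finite (PiE (UNIV :: 'n set) (\<lambda>_. A))" using A by (simp add: finite_PiE)
    show "vec_nth ` F \<subseteq> PiE UNIV (\<lambda>_. A)" by (auto simp: A_def)
  qed (auto intro!: prod_nonneg)
  also have "\<dots> = (\<Prod>i\<in>(UNIV :: 'n set). \<Sum>k\<in>A. ?e k)"
    by (subst prod_sum_PiE) (auto simp: A)
  also have "\<dots> = (\<Sum>k\<in>A. ?e k) ^ CARD('n)" by simp
  also have "\<dots> \<le> (\<Sum>\<^sub>\<infinity>k\<in>(UNIV :: int set). ?e k) ^ CARD('n)"
    by (intro power_mono finite_sum_le_infsum summable_gauss_int a A sum_nonneg) auto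
  finally show ?thesis .
qed

lemma norm_power2_add_ge:
  fixes u v :: "real^'n"
  shows "(norm (u + v))\<^sup>2 \<ge> (norm v)\<^sup>2 / 2 - (norm u)\<^sup>2"
proof -
  have "(v $ i)\<^sup>2 / 2 - (u $ i)\<^sup>2 \<le> ((u + v) $ i)\<^sup>2" for i
  proof -
    have "((u + v) $ i)\<^sup>2 - ((v $ i)\<^sup>2 / 2 - (u $ i)\<^sup>2) = 2 * (u $ i + v $ i / 2)\<^sup>2"
      by (simp add: power2_eq_square field_simps)
    also have "\<dots> \<ge> 0" by simp
    finally show ?thesis by simp
  qed
  then have "(\<Sum>i\<in>UNIV. (v $ i)\<^sup>2 / 2 - (u $ i)\<^sup>2) \<le> (\<Sum>i\<in>UNIV. ((u + v) $ i)\<^sup>2)"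
    by (intro sum_mono) simp
  then show ?thesis unfolding norm_power2_vec
    by (simp add: sum_subtractf sum_divide_distrib[symmetric])
qed

text \<open>
  Bounds on all finite partial sums give summability and a bound for the infinite sum at the same time.
  Uniformity in \<open>x\<close> comes from translating \<open>x\<close> by a lattice point into the unit cube, where the shift
  costs only a constant factor by \<open>norm_power2_add_ge\<close>.
\<close>

lemma lattice_gauss_sum_bounded:
  fixes \<kappa> :: real
  assumes "\<kappa> > 0"
  obtains S where "S > 0"
    and "\<And>(x :: real^'n) F. finite F \<Longrightarrow> (\<Sum>j\<in>F. exp (- (\<kappa> * (norm (x + lattice_point j))\<^sup>2))) \<le> S"
proof -
  define T where "T = (\<Sum>\<^sub>\<infinity>k\<in>(UNIV :: int set). exp (- (\<kappa> / 2 * (real_of_int k)\<^sup>2)))"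
  have bd: "(\<Sum>j\<in>F. exp (- (\<kappa> * (norm (x + lattice_point j))\<^sup>2))) \<le> exp (\<kappa> * CARD('n)) * T ^ CARD('n)"
    if F: "finite F" for x :: "real^'n" and F
  proof -
    define m where "m = (\<chi> i. \<lfloor>x $ i\<rfloor>)"
    define u where "u = x - lattice_point m"
    have "(u $ i)\<^sup>2 \<le> 1" for i
    proof -
      have "0 \<le> u $ i" "u $ i \<le> 1" by (simp_all add: u_def m_def lattice_point_def) linarith+
      then show ?thesis by (simp add: power_le_one)
    qed
    then have "(\<Sum>i\<in>UNIV. (u $ i)\<^sup>2) \<le> (\<Sum>i\<in>(UNIV :: 'n set). 1)" by (intro sum_mono) simp
    then have u: "(norm u)\<^sup>2 \<le> CARD('n)" by (simp add: norm_power2_vec)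
    have "(\<Sum>j\<in>F. exp (- (\<kappa> * (norm (x + lattice_point j))\<^sup>2)))
        \<le> (\<Sum>j\<in>F. exp (\<kappa> * CARD('n)) * exp (- (\<kappa> / 2 * (norm (lattice_point (j + m)))\<^sup>2)))"
    proof (rule sum_mono)
      fix j
      have eq: "x + lattice_point j = u + lattice_point (j + m)"
        by (simp add: u_def lattice_point_def vec_eq_iff)
      have "(norm (lattice_point (j + m)))\<^sup>2 / 2 - CARD('n) \<le> (norm (x + lattice_point j))\<^sup>2"
        unfolding eq using norm_power2_add_ge[of "lattice_point (j + m)" u] u by linarith
      then have "\<kappa> * ((norm (lattice_point (j + m)))\<^sup>2 / 2 - CARD('n)) \<le> \<kappa> * (norm (x + lattice_point j))\<^sup>2"
        using assms by simp
      then show "exp (- (\<kappa> * (norm (x + lattice_point j))\<^sup>2))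
          \<le> exp (\<kappa> * CARD('n)) * exp (- (\<kappa> / 2 * (norm (lattice_point (j + m)))\<^sup>2))"
        by (simp add: exp_add[symmetric] algebra_simps)
    qed
    also have "\<dots> = exp (\<kappa> * CARD('n)) *
        (\<Sum>j\<in>(\<lambda>j. j + m) ` F. exp (- (\<kappa> / 2 * (norm (lattice_point j))\<^sup>2)))"
      by (subst sum.reindex) (auto simp: sum_distrib_left inj_on_def)
    also have "\<dots> \<le> exp (\<kappa> * CARD('n)) * T ^ CARD('n)"
      unfolding T_def using assms F
      by (intro mult_left_mono lattice_gauss_sum_centered) auto
    finally show ?thesis .
  qed
  show ?thesis
  proof (rule that)
    show "exp (\<kappa> * CARD('n)) * T ^ CARD('n) + 1 > 0"
      using bd[of "{}" 0] by simp
    show "(\<Sum>j\<in>F. exp (- (\<kappa> * (norm (x + lattice_point j))\<^sup>2))) \<le> exp (\<kappa> * CARD('n)) * T ^ CARD('n) + 1"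
      if "finite F" for x :: "real^'n" and F
      using bd[OF that, of x] by simp
  qed
qed

lemma lattice_gauss_summable:
  fixes x :: "real^'n" and \<kappa> L :: real
  assumes "\<kappa> > 0" "L > 0"
  shows "(\<lambda>j. exp (- (\<kappa> * (norm (x + L *\<^sub>R lattice_point j))\<^sup>2))) summable_on UNIV"
proof -
  have "\<kappa> * L\<^sup>2 > 0" using assms by simp
  then obtain S where S: "\<And>(y :: real^'n) F. finite F \<Longrightarrow>
      (\<Sum>j\<in>F. exp (- (\<kappa> * L\<^sup>2 * (norm (y + lattice_point j))\<^sup>2))) \<le> S"
    using lattice_gauss_sum_bounded by metis
  have eq: "\<kappa> * (norm (x + L *\<^sub>R lattice_point j))\<^sup>2 = \<kappa> * L\<^sup>2 * (norm ((1 / L) *\<^sub>R x + lattice_point j))\<^sup>2" for j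
  proof -
    have "x + L *\<^sub>R lattice_point j = L *\<^sub>R ((1 / L) *\<^sub>R x + lattice_point j)"
      using assms by (simp add: scaleR_add_right)
    then show ?thesis by (simp add: power_mult_distrib)
  qed
  show ?thesis
    unfolding eq by (rule nonneg_bdd_above_summable_on) (auto intro!: bdd_aboveI2[where M = S] S)
qed

text \<open>
  The centres of the cubes of side \<open>h\<close> in the fundamental cell, together with their translates by
  \<open>h * n\<close> times integer vectors, form a single shifted lattice of mesh \<open>h\<close>. The double sum is therefore a sum of a
  Gaussian over that fine lattice. Rescaling by \<open>h\<close> makes it a sum over the integer lattice with decay rate
  \<open>a * h\<^sup>2 \<ge> \<kappa>\<close>.
\<close>

lemma cube_gauss_sum_bounded:
  fixes x :: "real^'n" and \<kappa> h S a :: real and n :: nat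
  assumes S: "\<And>(y :: real^'n) F. finite F \<Longrightarrow> (\<Sum>j\<in>F. exp (- (\<kappa> * (norm (y + lattice_point j))\<^sup>2))) \<le> S"
    and h: "h > 0" and n: "n > 0" and a: "\<kappa> \<le> a * h\<^sup>2" "a > 0"
  shows "(\<Sum>k\<in>PiE UNIV (\<lambda>_ :: 'n. {..<n}). \<Sum>\<^sub>\<infinity>j. exp (- (a *
            (norm (x - (\<chi> i. h * (real (k i) + 1 / 2)) + (h * real n) *\<^sub>R lattice_point j))\<^sup>2))) \<le> S"
proof -
  let ?K = "PiE UNIV (\<lambda>_ :: 'n. {..<n})"
  let ?f = "\<lambda>k j. exp (- (a * (norm (x - (\<chi> i. h * (real (k i) + 1 / 2)) + (h * real n) *\<^sub>R lattice_point j))\<^sup>2))"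
  have K: "finite ?K" by (simp add: finite_PiE)
  have summ: "?f k summable_on UNIV" for k
    by (rule lattice_gauss_summable) (use h n a in auto)
  have hs: "((\<lambda>j. \<Sum>k\<in>?K. ?f k j) has_sum (\<Sum>k\<in>?K. \<Sum>\<^sub>\<infinity>j. ?f k j)) UNIV"
    by (intro has_sum_finite_sum K has_sum_infsum summ)
  have "(\<Sum>k\<in>?K. \<Sum>\<^sub>\<infinity>j. ?f k j) = (\<Sum>\<^sub>\<infinity>j. \<Sum>k\<in>?K. ?f k j)"
    using infsumI[OF hs] by simp
  also have "\<dots> \<le> S"
  proof (rule infsum_le_finite_sums)
    show "(\<lambda>j. \<Sum>k\<in>?K. ?f k j) summable_on UNIV"
      using hs by (rule has_sum_imp_summable)
    fix F :: "(int^'n) set" assume F: "finite F" "F \<subseteq> UNIV"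
    define y where "y = (1 / h) *\<^sub>R x - (\<chi> i. 1 / 2)"
    define p where "p = (\<lambda>(j, k). (\<chi> i. int n * (j $ i) - int (k i)) :: int^'n)"
    have inj: "inj_on p (F \<times> ?K)"
    proof (rule inj_onI, clarify)
      fix j k j' k'
      assume k: "k \<in> ?K" and k': "k' \<in> ?K" and eq: "p (j, k) = p (j', k')"
      have "j $ i = j' $ i \<and> k i = k' i" for i
      proof -
        have e: "int n * (j $ i) - int (k i) = int n * (j' $ i) - int (k' i)"
          using eq by (simp add: p_def vec_eq_iff)
        have lt: "k i < n" "k' i < n" using k k' by (auto simp: PiE_iff)
        have "int n * (j $ i - j' $ i) = int (k i) - int (k' i)" using e by (simp add: algebra_simps)
        moreover have "\<bar>int (k i) - int (k' i)\<bar> < int n" using lt by linarith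
        ultimately have "int n * \<bar>j $ i - j' $ i\<bar> < int n * 1"
          using n by (metis abs_mult abs_of_nat mult.right_neutral)
        then have "j $ i = j' $ i" using n by simp
        with e show ?thesis by simp
      qed
      then show "j = j' \<and> k = k'" by (auto simp: vec_eq_iff)
    qed
    have "(\<Sum>j\<in>F. \<Sum>k\<in>?K. ?f k j) = (\<Sum>(j, k)\<in>F \<times> ?K. ?f k j)"
      by (simp add: sum.cartesian_product)
    also have "\<dots> \<le> (\<Sum>jk\<in>F \<times> ?K. exp (- (\<kappa> * (norm (y + lattice_point (p jk)))\<^sup>2)))"
    proof (rule sum_mono)
      fix jk :: "(int^'n) \<times> ('n \<Rightarrow> nat)"
      obtain j k where jk: "jk = (j, k)" by (cases jk)
      have eq: "x - (\<chi> i. h * (real (k i) + 1 / 2)) + (h * real n) *\<^sub>R lattice_point j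
          = h *\<^sub>R (y + lattice_point (p (j, k)))"
        using h by (simp add: y_def p_def lattice_point_def vec_eq_iff field_simps)
      have "\<kappa> * (norm (y + lattice_point (p (j, k))))\<^sup>2 \<le> a * h\<^sup>2 * (norm (y + lattice_point (p (j, k))))\<^sup>2"
        using a by (intro mult_right_mono) auto
      then have "?f k j \<le> exp (- (\<kappa> * (norm (y + lattice_point (p (j, k))))\<^sup>2))"
        unfolding eq by (simp add: power_mult_distrib mult.assoc)
      then show "(case jk of (j, k) \<Rightarrow> ?f k j) \<le> exp (- (\<kappa> * (norm (y + lattice_point (p jk)))\<^sup>2))"
        unfolding jk by simp
    qed
    also have "\<dots> = (\<Sum>m\<in>p ` (F \<times> ?K). exp (- (\<kappa> * (norm (y + lattice_point m))\<^sup>2)))"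
      by (simp add: sum.reindex[OF inj])
    also have "\<dots> \<le> S" by (rule S) (use F K in auto)
    finally show "(\<Sum>j\<in>F. \<Sum>k\<in>?K. ?f k j) \<le> S" .
  qed
  finally show ?thesis .
qed

section \<open>Local expansion of the periodised kernel\<close>

definition complexify :: "real^'n \<Rightarrow> complex^'n" where
  "complexify x = (\<chi> i. of_real (x $ i))"

lemma has_derivative_axis: "((\<lambda>w :: complex. z + axis i (w - a)) has_derivative (\<lambda>v. axis i v :: complex^'n)) (at b)"
proof -
  have "linear (\<lambda>v :: complex. axis i v :: complex^'n)"
    by (rule linearI) (auto simp: axis_def vec_eq_iff)
  then have lin: "bounded_linear (\<lambda>v :: complex. axis i v :: complex^'n)"
    by (rule linear_conv_bounded_linear[THEN iffD1])
  have "((\<lambda>w :: complex. w - a) has_derivative (\<lambda>v. v)) (at b)"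
    by (auto intro!: derivative_eq_intros)
  from bounded_linear.has_derivative[OF lin this]
  show ?thesis by (auto intro!: derivative_eq_intros)
qed

lemma H_infinity_separately_holomorphic:
  fixes \<phi> :: "complex^'n \<Rightarrow> complex"
  assumes phi: "\<phi> \<in> H_infinity L \<zeta>" and z: "\<And>j. \<bar>Im (z $ j)\<bar> < \<zeta>"
  shows "(\<lambda>w. \<phi> (\<chi> j. if j = i then w else z $ j)) field_differentiable at (z $ i)"
proof -
  define U :: "(complex^'n) set" where "U = {z. \<forall>j. \<bar>Im (z $ j)\<bar> < \<zeta>}"
  have "open U"
  proof -
    have "U = (\<Inter>j. {z. \<bar>Im (z $ j)\<bar> < \<zeta>})" by (auto simp: U_def)
    then show ?thesis by (auto intro!: open_INT open_Collect_less continuous_intros)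
  qed
  moreover have "U \<subseteq> complex_strip \<zeta>"
    unfolding U_def complex_strip_def by (auto intro: less_imp_le)
  ultimately have "U \<subseteq> interior (complex_strip \<zeta>)" by (rule interior_maximal[rotated])
  then have "z \<in> interior (complex_strip \<zeta>)" using z by (auto simp: U_def)
  then obtain f' where f': "(\<phi> has_derivative f') (at z)" "\<And>c v. f' (c *s v) = c * f' v"
    using phi unfolding H_infinity_def holomorphic_several_def by blast
  have u: "(\<chi> j. if j = i then w else z $ j) = z + axis i (w - z $ i)" for w
    by (simp add: vec_eq_iff axis_def)
  have "((\<lambda>w. \<phi> (z + axis i (w - z $ i))) has_derivative (\<lambda>v. f' (axis i v))) (at (z $ i))"
  proof (rule has_derivative_compose[OF has_derivative_axis])
    have "z + axis i (z $ i - z $ i) = z" by (simp add: axis_def vec_eq_iff)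
    then show "(\<phi> has_derivative f') (at (z + axis i (z $ i - z $ i)))" by (simp only: f'(1))
  qed
  moreover have "(\<lambda>v. f' (axis i v)) = (*) (f' (axis i 1))"
  proof
    fix v
    have "axis i v = v *s (axis i 1 :: complex^'n)"
      by (simp add: axis_def vec_eq_iff vector_scalar_mult_def)
    then show "f' (axis i v) = f' (axis i 1) * v" by (simp only: f'(2) mult.commute)
  qed
  ultimately have "((\<lambda>w. \<phi> (z + axis i (w - z $ i))) has_field_derivative f' (axis i 1)) (at (z $ i))"
    by (simp only: has_field_derivative_def)
  then show ?thesis unfolding u field_differentiable_def by blast
qed

text \<open>
  The analytic continuation of \<open>y \<mapsto> gauss_kernel (\<epsilon> / 2) (s - y)\<close>.
\<close>

definition complex_gauss :: "real \<Rightarrow> real^'n \<Rightarrow> complex^'n \<Rightarrow> complex" where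
  "complex_gauss \<epsilon> s z = of_real ((pi * \<epsilon>) powr (- (real CARD('n) / 2)))
     * exp (- ((\<Sum>k\<in>UNIV. (of_real (s $ k) - z $ k)\<^sup>2) / of_real \<epsilon>))"

lemma complex_gauss_complexify:
  fixes y :: "real^'n"
  shows "complex_gauss \<epsilon> s (complexify y) = of_real (gauss_kernel (\<epsilon> / 2) (s - y))"
proof -
  have "(\<Sum>k\<in>UNIV. (complex_of_real (s $ k) - complexify y $ k)\<^sup>2) = of_real ((norm (s - y))\<^sup>2)"
    by (simp add: complexify_def norm_power2_vec)
  then show ?thesis
    by (simp add: complex_gauss_def gauss_kernel_def exp_of_real[symmetric])
qed

text \<open>
  Moving the argument from \<open>q\<close> to a complex point at distance at most \<open>\<rho>\<close> in each coordinate costs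
  half of the Gaussian decay and a factor \<open>exp (d * \<rho>\<^sup>2 / \<epsilon>)\<close>, which stays bounded when \<open>\<rho>\<close> has order
  \<open>sqrt \<epsilon>\<close>. Coordinatewise this is \<open>(a - u)\<^sup>2 - v\<^sup>2 \<ge> a\<^sup>2 / 2 - (u\<^sup>2 + v\<^sup>2)\<close> for \<open>w = u + \<i> * v\<close>.
\<close>

lemma norm_complex_gauss_le:
  fixes q s :: "real^'n"
  assumes eps: "\<epsilon> > 0" and z: "\<And>k. norm (z $ k - complexify q $ k) \<le> \<rho>"
  shows "norm (complex_gauss \<epsilon> s z) \<le> (pi * \<epsilon>) powr (- (real CARD('n) / 2)) * exp (real CARD('n) * \<rho>\<^sup>2 / \<epsilon>)
            * exp (- (1 / (2 * \<epsilon>) * (norm (s - q))\<^sup>2))"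
proof -
  have "((s - q) $ k)\<^sup>2 / 2 - \<rho>\<^sup>2 \<le> Re ((of_real (s $ k) - z $ k)\<^sup>2)" for k
  proof -
    define w where "w = z $ k - complexify q $ k"
    define a where "a = (s - q) $ k"
    have "of_real (s $ k) - z $ k = of_real a - w"
      by (simp add: w_def a_def complexify_def)
    then have "Re ((of_real (s $ k) - z $ k)\<^sup>2) = (a - Re w)\<^sup>2 - (Im w)\<^sup>2"
      by (simp add: Re_power2)
    moreover have "(norm w)\<^sup>2 \<le> \<rho>\<^sup>2" using z[of k] by (intro power_mono) (auto simp: w_def)
    moreover have "(norm w)\<^sup>2 = (Re w)\<^sup>2 + (Im w)\<^sup>2" by (simp add: cmod_power2)
    moreover have "(a - Re w)\<^sup>2 - a\<^sup>2 / 2 + (Re w)\<^sup>2 = 2 * (a / 2 - Re w)\<^sup>2"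
      by (simp add: power2_eq_square field_simps)
    moreover have "0 \<le> 2 * (a / 2 - Re w)\<^sup>2" by simp
    ultimately show ?thesis unfolding a_def[symmetric] by linarith
  qed
  then have "(\<Sum>k\<in>UNIV. ((s - q) $ k)\<^sup>2 / 2 - \<rho>\<^sup>2) \<le> (\<Sum>k\<in>UNIV. Re ((of_real (s $ k) - z $ k)\<^sup>2))"
    by (intro sum_mono) simp
  then have "(norm (s - q))\<^sup>2 / 2 - real CARD('n) * \<rho>\<^sup>2 \<le> Re (\<Sum>k\<in>UNIV. (of_real (s $ k) - z $ k)\<^sup>2)"
    by (simp add: norm_power2_vec sum_subtractf sum_divide_distrib[symmetric])
  then have "((norm (s - q))\<^sup>2 / 2 - real CARD('n) * \<rho>\<^sup>2) / \<epsilon> \<le> Re (\<Sum>k\<in>UNIV. (of_real (s $ k) - z $ k)\<^sup>2) / \<epsilon>"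
    using eps by (intro divide_right_mono) auto
  then have "exp (- (Re (\<Sum>k\<in>UNIV. (of_real (s $ k) - z $ k)\<^sup>2) / \<epsilon>))
      \<le> exp (real CARD('n) * \<rho>\<^sup>2 / \<epsilon>) * exp (- (1 / (2 * \<epsilon>) * (norm (s - q))\<^sup>2))"
    by (simp add: exp_add[symmetric] diff_divide_distrib)
  then show ?thesis
    by (simp add: complex_gauss_def norm_mult mult.assoc mult_left_mono del: Re_sum)
qed

lemma complex_gauss_separately_holomorphic:
  "(\<lambda>w. complex_gauss \<epsilon> s (\<chi> j. if j = i then w else z $ j)) field_differentiable at (z $ i)" if "\<epsilon> > 0"
proof -
  have "(\<lambda>w. - ((\<Sum>k\<in>UNIV. (of_real (s $ k) - (if k = i then w else z $ k))\<^sup>2) / complex_of_real \<epsilon>))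
          field_differentiable at (z $ i)"
  proof (intro derivative_intros)
    show "(\<lambda>w. if k = i then w else z $ k) field_differentiable at (z $ i)" for k
      by (cases "k = i") (auto intro: derivative_intros)
  qed (use that in auto)
  from field_differentiable_compose[OF this, of exp]
  have "(\<lambda>w. exp (- ((\<Sum>k\<in>UNIV. (of_real (s $ k) - (if k = i then w else z $ k))\<^sup>2) / complex_of_real \<epsilon>)))
          field_differentiable at (z $ i)"
    using field_differentiable_within_exp unfolding comp_def by blast
  then show ?thesis
    unfolding complex_gauss_def by (auto intro!: derivative_intros)
qed

lemma per_gauss_kernel_has_sum:
  fixes x :: "real^'n"
  assumes "L > 0" "\<epsilon> > 0"
  shows "((\<lambda>j. gauss_kernel \<epsilon> (x + L *\<^sub>R lattice_point j)) has_sum per_gauss_kernel L \<epsilon> x) UNIV"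
proof -
  have "(\<lambda>j. exp (- (1 / (2 * \<epsilon>) * (norm (x + L *\<^sub>R lattice_point j))\<^sup>2))) summable_on UNIV"
    by (rule lattice_gauss_summable) (use assms in auto)
  from summable_on_cmult_right[OF this]
  have "(\<lambda>j. gauss_kernel \<epsilon> (x + L *\<^sub>R lattice_point j)) summable_on UNIV"
    by (simp add: gauss_kernel_def)
  then show ?thesis unfolding per_gauss_kernel_def lattice_point_def by (rule has_sum_infsum)
qed

text \<open>
  The unordered sum is the limit of its partial sums along an exhaustion of the countable lattice by
  finite sets.
\<close>

lemma borel_measurable_per_gauss_kernel:
  assumes "L > 0" "\<epsilon> > 0"
  shows "per_gauss_kernel L \<epsilon> \<in> borel_measurable (borel :: (real^'n) measure)"
proof (rule borel_measurable_LIMSEQ_real)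
  define A where "A m = {j :: int^'n. to_nat j < m}" for m
  have fin: "finite (A m)" for m
  proof -
    have "A m = to_nat -` {..<m}" by (auto simp: A_def)
    then show ?thesis by (simp add: finite_vimageI)
  qed
  have lim: "filterlim A (finite_subsets_at_top UNIV) sequentially"
    unfolding filterlim_finite_subsets_at_top
  proof (intro allI impI)
    fix Y :: "(int^'n) set" assume "finite Y \<and> Y \<subseteq> UNIV"
    then have Y: "finite Y" by simp
    define m0 where "m0 = Suc (Max (insert 0 (to_nat ` Y)))"
    have "to_nat j < m0" if "j \<in> Y" for j
      using Y that by (auto simp: m0_def less_Suc_eq_le intro!: Max_ge)
    then have "\<forall>m\<ge>m0. Y \<subseteq> A m" by (fastforce simp: A_def)
    then show "\<forall>\<^sub>F m in sequentially. finite (A m) \<and> Y \<subseteq> A m \<and> A m \<subseteq> UNIV"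
      unfolding eventually_sequentially using fin by (intro exI[of _ m0]) blast
  qed
  show "(\<lambda>m. \<Sum>j\<in>A m. gauss_kernel \<epsilon> (x + L *\<^sub>R lattice_point j)) \<longlonglongrightarrow> per_gauss_kernel L \<epsilon> x" for x :: "real^'n"
    using filterlim_compose[OF per_gauss_kernel_has_sum[OF assms, of x, unfolded has_sum_def] lim] .
  show "(\<lambda>x. \<Sum>j\<in>A m. gauss_kernel \<epsilon> (x + L *\<^sub>R lattice_point j)) \<in> borel_measurable borel" for m
    unfolding gauss_kernel_def by measurable
qed

lemma restrict_real_complexify: "restrict_real \<phi> x = \<phi> (complexify x)"
  by (simp add: restrict_real_def complexify_def)

lemma continuous_restrict_real:
  fixes \<phi> :: "complex^'n \<Rightarrow> complex"
  assumes "\<phi> \<in> H_infinity L \<zeta>" "\<zeta> \<ge> 0"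
  shows "continuous_on UNIV (restrict_real \<phi>)"
proof -
  have "continuous_on UNIV (\<lambda>x :: real^'n. \<phi> (\<chi> i. of_real (x $ i)))"
  proof (rule continuous_on_compose2[where g = \<phi>])
    show "continuous_on (complex_strip \<zeta>) \<phi>" using assms by (simp add: H_infinity_def)
    show "continuous_on UNIV (\<lambda>x :: real^'n. (\<chi> i. of_real (x $ i)) :: complex^'n)"
      by (intro continuous_intros)
    show "range (\<lambda>x :: real^'n. (\<chi> i. of_real (x $ i)) :: complex^'n) \<subseteq> complex_strip \<zeta>"
      using assms(2) by (auto simp: complex_strip_def)
  qed
  then show ?thesis unfolding restrict_real_def[abs_def] .
qed

text \<open>
  The polynomials \<open>interp_weight\<close> depend on the centre \<open>q\<close> only. All dependence on \<open>x\<close> and \<open>\<phi>\<close> sits in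
  the coefficients \<open>W\<close>, which are values of the complexified integrand at the nodes. The polydisc of radius
  \<open>2 * (\<zeta> / 4)\<close> that carries the estimates stays inside the open strip, and the expansion is valid in the
  cube of half-side \<open>\<zeta> / 8\<close>, half the radius of the nodes.
\<close>

lemma kernel_local_expansion:
  fixes x q :: "real^'n" and \<phi> :: "complex^'n \<Rightarrow> complex"
  assumes pos: "L > 0" "\<epsilon> > 0" "\<zeta> > 0" and N: "N > 0"
    and phi: "\<phi> \<in> H_infinity L \<zeta>" and phib: "sup_norm_on (complex_strip \<zeta>) \<phi> \<le> 1"
  defines "b \<equiv> (pi * \<epsilon>) powr (- (real CARD('n) / 2)) * exp (real CARD('n) * (\<zeta> / 2)\<^sup>2 / \<epsilon>)
            * (\<Sum>\<^sub>\<infinity>j. exp (- (1 / (2 * \<epsilon>) * (norm (x - q + L *\<^sub>R lattice_point j))\<^sup>2)))"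
  shows "\<exists>W. (\<forall>l. norm (W l) \<le> b) \<and> (\<forall>y. (\<forall>i. \<bar>y $ i - q $ i\<bar> \<le> \<zeta> / 8) \<longrightarrow>
      norm (of_real (per_gauss_kernel L (\<epsilon> / 2) (x - y)) * restrict_real \<phi> y
        - (1 / of_nat N) ^ CARD('n) * (\<Sum>l\<in>PiE UNIV (\<lambda>_. {..<N}). W l * interp_weight N (\<zeta> / 4) (complexify q) UNIV l (complexify y)))
      \<le> 2 ^ CARD('n) * 6 / 2 ^ N * b)"
proof -
  let ?q = "complexify q"
  let ?r = "\<zeta> / 4"
  define F where "F j z = \<phi> z * complex_gauss \<epsilon> (x + L *\<^sub>R lattice_point j) z" for j z
  define C where "C = (pi * \<epsilon>) powr (- (real CARD('n) / 2)) * exp (real CARD('n) * (\<zeta> / 2)\<^sup>2 / \<epsilon>)"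
  define \<beta> where "\<beta> j = C * exp (- (1 / (2 * \<epsilon>) * (norm (x - q + L *\<^sub>R lattice_point j))\<^sup>2))" for j
  have summ: "(\<lambda>j. exp (- (1 / (2 * \<epsilon>) * (norm (x - q + L *\<^sub>R lattice_point j))\<^sup>2))) summable_on UNIV"
    by (rule lattice_gauss_summable) (use pos in auto)
  then have beta: "\<beta> summable_on UNIV" unfolding \<beta>_def by (rule summable_on_cmult_right)
  have b: "infsum \<beta> UNIV = b"
    unfolding \<beta>_def b_def C_def by (rule infsum_cmult_right) (use summ in auto)
  have strip: "\<bar>Im (z $ j)\<bar> < \<zeta>" if "\<And>j. norm (z $ j - ?q $ j) \<le> 2 * ?r" for z j
  proof -
    have "\<bar>Im (z $ j)\<bar> = \<bar>Im (z $ j - ?q $ j)\<bar>" by (simp add: complexify_def)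
    also have "\<dots> \<le> 2 * ?r" using abs_Im_le_cmod that order_trans by blast
    finally show ?thesis using pos by simp
  qed
  have phi1: "norm (\<phi> z) \<le> 1" if "z \<in> complex_strip \<zeta>" for z
  proof -
    have "ereal (norm (\<phi> z)) \<le> sup_norm_on (complex_strip \<zeta>) \<phi>"
      unfolding sup_norm_on_def using that by (rule SUP_upper)
    then have "ereal (norm (\<phi> z)) \<le> 1" using phib by (rule order_trans)
    then show ?thesis by simp
  qed
  have hol: "(\<lambda>w. F j (\<chi> k. if k = i then w else z $ k)) field_differentiable at (z $ i)"
    if "\<And>k. norm (z $ k - ?q $ k) \<le> 2 * ?r" for j z i
    unfolding F_def
    by (intro derivative_intros H_infinity_separately_holomorphic[OF phi strip[OF that]]
        complex_gauss_separately_holomorphic pos)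
  have bound: "norm (F j z) \<le> \<beta> j" if z: "\<And>k. norm (z $ k - ?q $ k) \<le> 2 * ?r" for j z
  proof -
    have "norm (\<phi> z) \<le> 1"
      by (rule phi1) (use strip[OF z] in \<open>auto simp: complex_strip_def intro: less_imp_le\<close>)
    moreover have "norm (complex_gauss \<epsilon> (x + L *\<^sub>R lattice_point j) z) \<le> \<beta> j"
    proof -
      have "norm (z $ k - ?q $ k) \<le> \<zeta> / 2" for k using z[of k] by simp
      from norm_complex_gauss_le[OF pos(2) this, of "x + L *\<^sub>R lattice_point j"]
      show ?thesis by (simp add: \<beta>_def C_def algebra_simps)
    qed
    ultimately show ?thesis
      unfolding F_def norm_mult using mult_mono[of "norm (\<phi> z)" 1] by fastforce
  qed
  have r: "?r > 0" using pos by simp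
  show ?thesis
  proof (intro exI[of _ "\<lambda>l. \<Sum>\<^sub>\<infinity>j. F j (interp_node N ?r ?q UNIV l ?q)"] conjI allI impI)
    show "norm (\<Sum>\<^sub>\<infinity>j. F j (interp_node N ?r ?q UNIV l ?q)) \<le> b" for l
      unfolding b[symmetric] by (rule discrete_cauchy_series(1)[OF r N beta hol bound])
    fix y :: "real^'n"
    assume y: "\<forall>i. \<bar>y $ i - q $ i\<bar> \<le> \<zeta> / 8"
    have y': "norm (complexify y $ j - ?q $ j) \<le> ?r / 2" for j
      using spec[OF y, of j] by (simp add: complexify_def of_real_diff[symmetric] norm_of_real del: of_real_diff)
    have "((\<lambda>j. gauss_kernel (\<epsilon> / 2) (x - y + L *\<^sub>R lattice_point j)) has_sum per_gauss_kernel L (\<epsilon> / 2) (x - y)) UNIV"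
      by (rule per_gauss_kernel_has_sum) (use pos in auto)
    from has_sum_cmult_right[OF has_sum_of_real[OF this], of "restrict_real \<phi> y"]
    have "((\<lambda>j. F j (complexify y)) has_sum (of_real (per_gauss_kernel L (\<epsilon> / 2) (x - y)) * restrict_real \<phi> y)) UNIV"
      by (simp add: F_def complex_gauss_complexify restrict_real_complexify algebra_simps)
    then have sum: "(\<Sum>\<^sub>\<infinity>j. F j (complexify y)) = of_real (per_gauss_kernel L (\<epsilon> / 2) (x - y)) * restrict_real \<phi> y"
      by (rule infsumI)
    show "norm (of_real (per_gauss_kernel L (\<epsilon> / 2) (x - y)) * restrict_real \<phi> y
        - (1 / of_nat N) ^ CARD('n) * (\<Sum>l\<in>PiE UNIV (\<lambda>_. {..<N}).
            (\<Sum>\<^sub>\<infinity>j. F j (interp_node N ?r ?q UNIV l ?q)) * interp_weight N ?r ?q UNIV l (complexify y)))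
      \<le> 2 ^ CARD('n) * 6 / 2 ^ N * b"
      unfolding b[symmetric] sum[symmetric] by (rule discrete_cauchy_series(2)[OF r N beta hol bound y'])
  qed
qed

section \<open>Test functions on the cubes of a grid\<close>

definition grid_cube :: "real \<Rightarrow> ('n \<Rightarrow> nat) \<Rightarrow> (real^'n) set" where
  "grid_cube h k = {y. \<forall>i. h * real (k i) \<le> y $ i \<and> y $ i < h * (real (k i) + 1)}"

definition cube_center :: "real \<Rightarrow> ('n \<Rightarrow> nat) \<Rightarrow> real^'n" where
  "cube_center h k = (\<chi> i. h * (real (k i) + 1 / 2))"

definition cube_test_function ::
    "nat \<Rightarrow> real \<Rightarrow> real \<Rightarrow> ('n \<Rightarrow> nat) \<times> ('n \<Rightarrow> nat) \<Rightarrow> real^'n \<Rightarrow> complex" where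
  "cube_test_function N r h = (\<lambda>(k, l) y. indicator (grid_cube h k) y *
     interp_weight N r (complexify (cube_center h k)) UNIV l (complexify y))"

lemma dist_cube_center:
  assumes "y \<in> grid_cube h k"
  shows "\<bar>y $ i - cube_center h k $ i\<bar> \<le> h / 2"
proof -
  have "h * real (k i) \<le> y $ i" "y $ i \<le> h * (real (k i) + 1)"
    using assms by (auto simp: grid_cube_def intro: less_imp_le)
  then have "y $ i - cube_center h k $ i \<le> h / 2" "- (y $ i - cube_center h k $ i) \<le> h / 2"
    by (simp_all add: cube_center_def algebra_simps)
  then show ?thesis by (rule abs_leI)
qed

lemma norm_cube_test_function:
  fixes y :: "real^'n"
  assumes "r > 0" "h \<le> r"
  shows "norm (cube_test_function N r h (k, l) y) \<le> 2 ^ CARD('n) * indicator (grid_cube h k) y"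
proof (cases "y \<in> grid_cube h k")
  case True
  have "norm (complexify y $ i - complexify (cube_center h k) $ i) \<le> r / 2" for i
  proof -
    have "norm (complexify y $ i - complexify (cube_center h k) $ i) = \<bar>y $ i - cube_center h k $ i\<bar>"
      by (simp add: complexify_def of_real_diff[symmetric] norm_of_real del: of_real_diff)
    also have "\<dots> \<le> r / 2" using dist_cube_center[OF True, of i] assms(2) by simp
    finally show ?thesis .
  qed
  then have "norm (interp_weight N r (complexify (cube_center h k)) UNIV l (complexify y)) \<le> 2 ^ CARD('n)"
    using norm_interp_weight[OF assms(1), of UNIV "complexify y"] by blast
  then show ?thesis using True by (simp add: cube_test_function_def)
qed (simp add: cube_test_function_def)

lemma grid_cube_borel: "grid_cube h k \<in> sets (borel :: (real^'n) measure)"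
proof -
  have "grid_cube h k = (\<Inter>i. {y :: real^'n. h * real (k i) \<le> y $ i} \<inter> {y. y $ i < h * (real (k i) + 1)})"
    by (auto simp: grid_cube_def)
  also have "\<dots> \<in> sets borel"
    by (intro sets.finite_INT sets.Int) (auto intro!: borel_closed borel_open closed_Collect_le open_Collect_less continuous_intros)
  finally show ?thesis .
qed

lemma borel_measurable_cube_test_function:
  "cube_test_function N r h kl \<in> borel_measurable (borel :: (real^'n) measure)" if "r > 0"
proof -
  obtain k l where kl: "kl = (k, l)" by (cases kl)
  have "continuous_on UNIV (\<lambda>y :: real^'n. interp_weight N r (complexify (cube_center h k)) UNIV l (complexify y))"
    unfolding interp_weight_def geom_poly_def complexify_def
    using that by (auto intro!: continuous_intros)
  then show ?thesis
    unfolding kl cube_test_function_def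
    by (simp, intro borel_measurable_times borel_measurable_indicator grid_cube_borel borel_measurable_continuous_onI)
qed

lemma emeasure_grid_cube:
  "emeasure lborel (grid_cube h k :: (real^'n) set) \<le> ennreal (h ^ CARD('n))" if "h \<ge> 0"
proof -
  let ?a = "(\<chi> i. h * real (k i)) :: real^'n" and ?b = "(\<chi> i. h * (real (k i) + 1)) :: real^'n"
  have sub: "grid_cube h k \<subseteq> cbox ?a ?b"
    by (auto simp: grid_cube_def mem_box_cart less_imp_le)
  have ne: "cbox ?a ?b \<noteq> {}"
    using that by (auto simp: interval_ne_empty_cart intro!: mult_left_mono)
  have "emeasure lborel (grid_cube h k :: (real^'n) set) \<le> emeasure lborel (cbox ?a ?b)"
    by (rule emeasure_mono[OF sub]) auto
  also have "\<dots> = ennreal (measure lborel (cbox ?a ?b))"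
    by (rule emeasure_eq_ennreal_measure) (use emeasure_lborel_cbox_finite in \<open>auto simp: top.not_eq_extremum\<close>)
  also have "measure lborel (cbox ?a ?b) = (\<Prod>i\<in>(UNIV :: 'n set). h)"
    using content_cbox_cart[OF ne] by (simp add: algebra_simps)
  finally show ?thesis by simp
qed

lemma density_grid_cube_le:
  fixes \<rho> :: "real^'n \<Rightarrow> real"
  assumes rho: "bounded_density L R \<rho>" and h: "h \<ge> 0" and R: "R \<ge> 0"
  defines "D \<equiv> density (torus_measure L) (\<lambda>x. ennreal (\<rho> x))"
  shows "emeasure D (grid_cube h k \<inter> torus_cell L) \<le> ennreal (R * h ^ CARD('n))"
proof -
  let ?T = "torus_measure L :: (real^'n) measure"
  let ?Q = "grid_cube h k \<inter> torus_cell L :: (real^'n) set"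
  have rhom: "(\<lambda>x. ennreal (\<rho> x)) \<in> borel_measurable ?T"
    using rho by (auto simp: bounded_density_def)
  have cell: "torus_cell L \<in> sets (lborel :: (real^'n) measure)"
  proof -
    have "torus_cell L = (\<Inter>i. {y :: real^'n. 0 \<le> y $ i} \<inter> {y. y $ i < L})"
      by (auto simp: torus_cell_def)
    also have "\<dots> \<in> sets borel"
      by (intro sets.finite_INT sets.Int) (auto intro!: borel_closed borel_open closed_Collect_le open_Collect_less continuous_intros)
    finally show ?thesis by simp
  qed
  have Q: "?Q \<in> sets ?T"
    using grid_cube_borel[of h k] cell by (auto simp: torus_measure_def sets_restrict_space)
  have "AE x in ?T. ereal \<bar>\<rho> x\<bar> \<le> ereal R"
    using esssup_AE[of "\<lambda>x. ereal \<bar>\<rho> x\<bar>" ?T] rho by (simp add: bounded_density_def)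
  then have le: "AE x in ?T. ennreal (\<rho> x) * indicator ?Q x \<le> ennreal R * indicator ?Q x"
  proof eventually_elim
    case (elim x)
    then have "\<rho> x \<le> R" by simp
    then show ?case by (intro mult_right_mono ennreal_leI) auto
  qed
  have "emeasure D ?Q = (\<integral>\<^sup>+ x. ennreal (\<rho> x) * indicator ?Q x \<partial>?T)"
    unfolding D_def by (rule emeasure_density[OF rhom Q])
  also have "\<dots> \<le> (\<integral>\<^sup>+ x. ennreal R * indicator ?Q x \<partial>?T)"
    by (rule nn_integral_mono_AE[OF le])
  also have "\<dots> = ennreal R * emeasure ?T ?Q"
    using Q by (rule nn_integral_cmult_indicator)
  also have "emeasure ?T ?Q = emeasure lborel ?Q"
    unfolding torus_measure_def by (rule emeasure_restrict_space) (use cell in auto)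
  also have "\<dots> \<le> emeasure lborel (grid_cube h k :: (real^'n) set)"
    by (rule emeasure_mono) (use grid_cube_borel[of h k] in auto)
  also have "\<dots> \<le> ennreal (h ^ CARD('n))" by (rule emeasure_grid_cube[OF h])
  finally show ?thesis
    using R h by (simp add: ennreal_mult mult_left_mono)
qed

lemma torus_cell_in_grid_cube:
  fixes y :: "real^'n"
  assumes y: "y \<in> torus_cell (h * real n)" and h: "h > 0"
  obtains k where "k \<in> PiE UNIV (\<lambda>_. {..<n})" "y \<in> grid_cube h k"
    "\<And>k'. y \<in> grid_cube h k' \<Longrightarrow> k' = k"
proof -
  have unique: "k' i = nat \<lfloor>y $ i / h\<rfloor>" if "y \<in> grid_cube h k'" for k' i
  proof -
    have "h * real (k' i) \<le> y $ i" "y $ i < h * (real (k' i) + 1)" using that by (auto simp: grid_cube_def)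
    then have "of_int (int (k' i)) \<le> y $ i / h" "y $ i / h < of_int (int (k' i)) + 1"
      using h by (simp_all add: field_simps)
    then have "\<lfloor>y $ i / h\<rfloor> = int (k' i)" by (rule floor_unique)
    then show ?thesis by simp
  qed
  define k where "k i = nat \<lfloor>y $ i / h\<rfloor>" for i
  have y0: "0 \<le> y $ i" "y $ i < h * real n" for i using y by (auto simp: torus_cell_def)
  have fl: "real (k i) = of_int \<lfloor>y $ i / h\<rfloor>" for i
    using y0[of i] h by (simp add: k_def)
  have a: "real (k i) \<le> y $ i / h" "y $ i / h < real (k i) + 1" for i
    unfolding fl by linarith+
  show ?thesis
  proof (rule that)
    show "y \<in> grid_cube h k"
      unfolding grid_cube_def using a h by (simp add: field_simps)
    have "k i < n" for i
    proof -
      have "y $ i / h < real n" using y0[of i] h by (simp add: field_simps)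
      then have "real (k i) < real n" using a(1)[of i] by linarith
      then show ?thesis by simp
    qed
    then show "k \<in> PiE UNIV (\<lambda>_. {..<n})" by auto
    show "k' = k" if "y \<in> grid_cube h k'" for k' using unique[OF that] by (auto simp: k_def)
  qed
qed

text \<open>
  The local expansions on the separate cubes combine into one finite linear combination of the test
  functions. The weights of the nodes are averages over \<open>N ^ d\<close> values bounded by \<open>b k\<close>, so the \<open>\<ell>\<^sup>1\<close>
  norm of all coefficients is at most \<open>\<Sum>k. b k \<le> A\<close>, independently of \<open>N\<close>.
\<close>

lemma kernel_error_pointwise_le:
  fixes \<rho> :: "real^'n \<Rightarrow> real" and \<phi> :: "complex^'n \<Rightarrow> complex" and n N M :: nat
  assumes rho: "bounded_density L R \<rho>"
    and pos: "L > 0" "\<epsilon> > 0" "Z\<^sub>0 > 0" "n > 0" "N > 0" "M > 0"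
    and pts: "\<And>i. i \<in> {1..M} \<Longrightarrow> xs i \<in> torus_cell L"
    and S: "\<And>(y :: real^'n) F. finite F \<Longrightarrow> (\<Sum>j\<in>F. exp (- (\<kappa> * (norm (y + lattice_point j))\<^sup>2))) \<le> S"
  defines "\<zeta> \<equiv> Z\<^sub>0 * sqrt \<epsilon>" and "h \<equiv> L / real n"
  defines "D \<equiv> density (torus_measure L) (\<lambda>x. ennreal (\<rho> x))"
  defines "A \<equiv> (pi * \<epsilon>) powr (- (real CARD('n) / 2)) * exp (real CARD('n) * (\<zeta> / 2)\<^sup>2 / \<epsilon>) * S"
  assumes h: "h \<le> \<zeta> / 4" "\<kappa> \<le> 1 / (2 * \<epsilon>) * h\<^sup>2"
    and dev: "\<And>kl. kl \<in> PiE UNIV (\<lambda>_. {..<n}) \<times> PiE UNIV (\<lambda>_. {..<N}) \<Longrightarrow>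
      norm (1 / of_nat M * (\<Sum>m\<in>{1..M}. cube_test_function N (\<zeta> / 4) h kl (xs m))
        - (\<integral>y. cube_test_function N (\<zeta> / 4) h kl y \<partial>D)) \<le> t"
    and t: "t \<ge> 0"
    and phi: "\<phi> \<in> H_infinity L \<zeta>" "sup_norm_on (complex_strip \<zeta>) \<phi> \<le> 1"
  shows "norm (sampled_kernel_op L (\<epsilon> / 2) M xs (restrict_real \<phi>) x - kernel_op L (\<epsilon> / 2) \<rho> (restrict_real \<phi>) x)
      \<le> A * t + 2 * (2 ^ CARD('n) * 6 / 2 ^ N * A)"
proof -
  let ?K = "PiE UNIV (\<lambda>_. {..<n}) :: ('n \<Rightarrow> nat) set"
  let ?N = "PiE UNIV (\<lambda>_. {..<N}) :: ('n \<Rightarrow> nat) set"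
  let ?e = "2 ^ CARD('n) * 6 / 2 ^ N :: real"
  let ?T = "torus_measure L :: (real^'n) measure"
  have zeta: "\<zeta> > 0" using pos by (simp add: \<zeta>_def)
  have h0: "h > 0" and hn: "h * real n = L" using pos by (simp_all add: h_def)
  have fin: "finite ?K" "finite ?N" by (simp_all add: finite_PiE)
  have cardN: "card ?N = N ^ CARD('n)" by (simp add: card_PiE)
  have rhom: "\<rho> \<in> borel_measurable ?T" "AE x in ?T. 0 \<le> \<rho> x"
    using rho by (auto simp: bounded_density_def)
  have spaceD: "space D = torus_cell L"
    by (simp add: D_def torus_measure_def space_restrict_space)
  have measD: "f \<in> borel_measurable D" if "f \<in> borel_measurable borel" for f :: "real^'n \<Rightarrow> complex"
    using that unfolding D_def torus_measure_def
    by (auto intro!: measurable_restrict_space1)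
  have probD: "prob_space D"
  proof
    have "emeasure D (space D) = (\<integral>\<^sup>+ x. ennreal (\<rho> x) * indicator (space ?T) x \<partial>?T)"
      unfolding D_def by (subst emeasure_density) (use rhom in auto)
    also have "\<dots> = (\<integral>\<^sup>+ x. ennreal (\<rho> x) \<partial>?T)"
      by (rule nn_integral_cong) auto
    finally show "emeasure D (space D) = 1" using rho by (simp add: bounded_density_def)
  qed
  define F where "F y = of_real (per_gauss_kernel L (\<epsilon> / 2) (x - y)) * restrict_real \<phi> y" for y
  define b where "b k = (pi * \<epsilon>) powr (- (real CARD('n) / 2)) * exp (real CARD('n) * (\<zeta> / 2)\<^sup>2 / \<epsilon>)
      * (\<Sum>\<^sub>\<infinity>j. exp (- (1 / (2 * \<epsilon>) * (norm (x - cube_center h k + L *\<^sub>R lattice_point j))\<^sup>2)))"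
    for k :: "'n \<Rightarrow> nat"
  let ?app = "\<lambda>V k y. (1 / of_nat N) ^ CARD('n) * (\<Sum>l\<in>?N. V l *
          interp_weight N (\<zeta> / 4) (complexify (cube_center h k)) UNIV l (complexify y))"
  define good where "good k V \<longleftrightarrow> (\<forall>l. norm (V l) \<le> b k) \<and>
      (\<forall>y. (\<forall>i. \<bar>y $ i - cube_center h k $ i\<bar> \<le> \<zeta> / 8) \<longrightarrow> norm (F y - ?app V k y) \<le> ?e * b k)"
    for k :: "'n \<Rightarrow> nat" and V
  have "\<exists>V. good k V" for k
    unfolding good_def b_def F_def
    by (rule kernel_local_expansion[OF pos(1,2) zeta pos(5) phi])
  then have "\<forall>k. \<exists>V. good k V" by blast
  from choice[OF this] obtain W where good: "\<forall>k. good k (W k)" by (rule exE)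
  have W: "norm (W k l) \<le> b k" for k l
    using spec[OF good, of k] unfolding good_def by (rule conjunct1[THEN spec])
  have exp: "norm (F y - ?app (W k) k y) \<le> ?e * b k" if "\<And>i. \<bar>y $ i - cube_center h k $ i\<bar> \<le> \<zeta> / 8" for k y
    using spec[OF good, of k] that unfolding good_def by simp
  have b0: "b k \<ge> 0" for k by (rule order_trans[OF norm_ge_zero W])
  \<comment> \<open>The constant \<open>b k\<close> is a Gaussian sum seen from the centre of cube \<open>k\<close>; summing over the
     cubes gives a Riemann sum.\<close>
  have bsum: "(\<Sum>k\<in>?K. b k) \<le> A"
  proof -
    have "(\<Sum>k\<in>?K. \<Sum>\<^sub>\<infinity>j. exp (- (1 / (2 * \<epsilon>) * (norm (x - cube_center h k + L *\<^sub>R lattice_point j))\<^sup>2))) \<le> S"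
      using cube_gauss_sum_bounded[OF S h0 pos(4) h(2), of x] pos(2)
      unfolding hn cube_center_def by simp
    then show ?thesis
      unfolding b_def A_def sum_distrib_left[symmetric] by (intro mult_left_mono) auto
  qed
  have Fborel: "F \<in> borel_measurable borel"
  proof -
    have [measurable]: "(\<lambda>y. per_gauss_kernel L (\<epsilon> / 2) (x - y)) \<in> borel_measurable borel"
      by (rule measurable_compose[OF _ borel_measurable_per_gauss_kernel]) (use pos in auto)
    have [measurable]: "restrict_real \<phi> \<in> borel_measurable borel"
      using continuous_restrict_real[OF phi(1)] zeta by (intro borel_measurable_continuous_onI) auto
    show ?thesis unfolding F_def by measurable
  qed
  define w where "w = (\<lambda>(k, l). (1 / of_nat N) ^ CARD('n) * W k l)"
  have "norm (1 / of_nat M * (\<Sum>m\<in>{1..M}. F (xs m)) - (\<integral>y. F y \<partial>D)) \<le> A * t + 2 * (?e * A)"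
  proof (rule empirical_error_transfer[OF probD pos(6), where I = "?K \<times> ?N"
        and \<psi> = "cube_test_function N (\<zeta> / 4) h" and w = w and B = "2 ^ CARD('n)"])
    show "xs i \<in> space D" if "i \<in> {1..M}" for i using pts[OF that] by (simp add: spaceD)
    show "F \<in> borel_measurable D" by (rule measD[OF Fborel])
    show "finite (?K \<times> ?N)" using fin by simp
    show "cube_test_function N (\<zeta> / 4) h kl \<in> borel_measurable D" for kl
      by (intro measD borel_measurable_cube_test_function) (use zeta in simp)
    show "norm (cube_test_function N (\<zeta> / 4) h kl y) \<le> 2 ^ CARD('n)" for kl and y :: "real^'n"
    proof -
      obtain k l where kl: "kl = (k, l)" by (cases kl)
      show ?thesis
        using norm_cube_test_function[of "\<zeta> / 4" h N k l y, OF _ h(1)] zeta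
        unfolding kl by (cases "y \<in> grid_cube h k") (simp_all add: order_trans)
    qed
    show "(\<Sum>kl\<in>?K \<times> ?N. norm (w kl)) \<le> A"
    proof -
      have "(\<Sum>kl\<in>?K \<times> ?N. norm (w kl)) = (\<Sum>k\<in>?K. \<Sum>l\<in>?N. norm (w (k, l)))"
        by (simp add: sum.cartesian_product)
      also have "\<dots> \<le> (\<Sum>k\<in>?K. \<Sum>l\<in>?N. (1 / real N) ^ CARD('n) * b k)"
        by (intro sum_mono) (auto simp: w_def norm_mult norm_power norm_divide intro!: mult_left_mono W)
      also have "\<dots> = (\<Sum>k\<in>?K. b k)"
        using pos(5) by (simp add: cardN power_divide)
      also have "\<dots> \<le> A" by (rule bsum)
      finally show ?thesis .
    qed
    show "norm (F y - (\<Sum>kl\<in>?K \<times> ?N. w kl * cube_test_function N (\<zeta> / 4) h kl y)) \<le> ?e * A"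
      if "y \<in> space D" for y
    proof -
      have "y \<in> torus_cell (h * real n)" using that by (simp add: spaceD hn)
      then obtain k where k: "k \<in> ?K" "y \<in> grid_cube h k"
        and uniq: "\<And>k'. y \<in> grid_cube h k' \<Longrightarrow> k' = k"
        using torus_cell_in_grid_cube h0 by metis
      have "(\<Sum>kl\<in>?K \<times> ?N. w kl * cube_test_function N (\<zeta> / 4) h kl y)
          = (\<Sum>k'\<in>?K. \<Sum>l\<in>?N. w (k', l) * cube_test_function N (\<zeta> / 4) h (k', l) y)"
        by (simp add: sum.cartesian_product)
      also have "\<dots> = (\<Sum>k'\<in>?K. if k' = k then ?app (W k) k y else 0)"
      proof (rule sum.cong[OF refl])
        fix k' assume "k' \<in> ?K"
        show "(\<Sum>l\<in>?N. w (k', l) * cube_test_function N (\<zeta> / 4) h (k', l) y)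
            = (if k' = k then ?app (W k) k y else 0)"
        proof (cases "k' = k")
          case True
          then show ?thesis
            using k(2) by (simp add: w_def cube_test_function_def sum_distrib_left mult.assoc)
        next
          case False
          then have "y \<notin> grid_cube h k'" using uniq by blast
          then show ?thesis using False by (simp add: cube_test_function_def)
        qed
      qed
      also have "\<dots> = ?app (W k) k y" using k(1) fin by simp
      finally have eq: "(\<Sum>kl\<in>?K \<times> ?N. w kl * cube_test_function N (\<zeta> / 4) h kl y) = ?app (W k) k y" .
      have near: "\<bar>y $ i - cube_center h k $ i\<bar> \<le> \<zeta> / 8" for i
        using dist_cube_center[OF k(2), of i] h(1) by simp
      have "b k \<le> (\<Sum>k\<in>?K. b k)" using k(1) fin b0 by (intro member_le_sum) auto
      then have "b k \<le> A" using bsum by simp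
      then have "?e * b k \<le> ?e * A" by (intro mult_left_mono) auto
      then show ?thesis using exp[OF near] unfolding eq by (rule order_trans[rotated])
    qed
    show "norm (1 / of_nat M * (\<Sum>m\<in>{1..M}. cube_test_function N (\<zeta> / 4) h kl (xs m))
      - (\<integral>y. cube_test_function N (\<zeta> / 4) h kl y \<partial>D)) \<le> t" if "kl \<in> ?K \<times> ?N" for kl
      using that by (rule dev)
  qed (rule t)
  moreover have "sampled_kernel_op L (\<epsilon> / 2) M xs (restrict_real \<phi>) x = 1 / of_nat M * (\<Sum>m\<in>{1..M}. F (xs m))"
    by (simp add: sampled_kernel_op_def F_def)
  moreover have "kernel_op L (\<epsilon> / 2) \<rho> (restrict_real \<phi>) x = (\<integral>y. F y \<partial>D)"
  proof -
    have "F \<in> borel_measurable ?T"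
      using Fborel unfolding torus_measure_def by (auto intro!: measurable_restrict_space1)
    then have "(\<integral>y. F y \<partial>D) = (\<integral>y. \<rho> y *\<^sub>R F y \<partial>?T)"
      unfolding D_def by (rule integral_density) (rule rhom)+
    also have "\<dots> = kernel_op L (\<epsilon> / 2) \<rho> (restrict_real \<phi>) x"
      unfolding kernel_op_def
      by (rule Bochner_Integration.integral_cong) (simp_all add: F_def scaleR_conv_of_real mult_ac)
    finally show ?thesis by simp
  qed
  ultimately show ?thesis by simp
qed

lemma kernel_error_le:
  fixes \<rho> :: "real^'n \<Rightarrow> real" and n N M :: nat
  assumes rho: "bounded_density L R \<rho>"
    and pos: "L > 0" "\<epsilon> > 0" "Z\<^sub>0 > 0" "n > 0" "N > 0" "M > 0"
    and pts: "\<And>i. i \<in> {1..M} \<Longrightarrow> xs i \<in> torus_cell L"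
    and S: "\<And>(y :: real^'n) F. finite F \<Longrightarrow> (\<Sum>j\<in>F. exp (- (\<kappa> * (norm (y + lattice_point j))\<^sup>2))) \<le> S"
  defines "\<zeta> \<equiv> Z\<^sub>0 * sqrt \<epsilon>" and "h \<equiv> L / real n"
  defines "D \<equiv> density (torus_measure L) (\<lambda>x. ennreal (\<rho> x))"
  defines "A \<equiv> (pi * \<epsilon>) powr (- (real CARD('n) / 2)) * exp (real CARD('n) * (\<zeta> / 2)\<^sup>2 / \<epsilon>) * S"
  assumes h: "h \<le> \<zeta> / 4" "\<kappa> \<le> 1 / (2 * \<epsilon>) * h\<^sup>2"
    and dev: "\<And>kl. kl \<in> PiE UNIV (\<lambda>_. {..<n}) \<times> PiE UNIV (\<lambda>_. {..<N}) \<Longrightarrow>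
      norm (1 / of_nat M * (\<Sum>m\<in>{1..M}. cube_test_function N (\<zeta> / 4) h kl (xs m))
        - (\<integral>y. cube_test_function N (\<zeta> / 4) h kl y \<partial>D)) \<le> t"
    and t: "t \<ge> 0"
  shows "kernel_error L Z\<^sub>0 \<epsilon> \<rho> M xs \<le> ereal (A * t + 2 * (2 ^ CARD('n) * 6 / 2 ^ N * A))"
  unfolding kernel_error_def op_norm_H_C_def sup_norm_on_def[of "torus_cell L"]
proof (intro SUP_least)
  fix \<phi> :: "complex^'n \<Rightarrow> complex" and x :: "real^'n"
  assume "\<phi> \<in> {\<phi> \<in> H_infinity L (Z\<^sub>0 * sqrt \<epsilon>). sup_norm_on (complex_strip (Z\<^sub>0 * sqrt \<epsilon>)) \<phi> \<le> 1}"
  then have phi: "\<phi> \<in> H_infinity L (Z\<^sub>0 * sqrt \<epsilon>)" "sup_norm_on (complex_strip (Z\<^sub>0 * sqrt \<epsilon>)) \<phi> \<le> 1"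
    by simp_all
  show "ereal (norm (sampled_kernel_op L (\<epsilon> / 2) M xs (restrict_real \<phi>) x - kernel_op L (\<epsilon> / 2) \<rho> (restrict_real \<phi>) x))
      \<le> ereal (A * t + 2 * (2 ^ CARD('n) * 6 / 2 ^ N * A))"
    using kernel_error_pointwise_le[OF rho pos pts S h[unfolded \<zeta>_def h_def] dev[unfolded \<zeta>_def h_def D_def] t phi, of x]
    unfolding A_def \<zeta>_def by simp
qed

text \<open>
  The test function is bounded by \<open>2 ^ d\<close> and vanishes off its cube, whose probability is at most
  \<open>R * h ^ d\<close>.
\<close>

lemma cube_test_function_second_moment:
  fixes \<rho> :: "real^'n \<Rightarrow> real"
  assumes rho: "bounded_density L R \<rho>" and r: "r > 0" and h: "0 \<le> h" "h \<le> r" and R: "R \<ge> 0"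
  defines "D \<equiv> density (torus_measure L) (\<lambda>x. ennreal (\<rho> x))"
  shows "(\<integral>y. (norm (cube_test_function N r h kl y))\<^sup>2 \<partial>D) \<le> 4 ^ CARD('n) * (R * h ^ CARD('n))"
proof -
  obtain k l where kl: "kl = (k, l)" by (cases kl)
  let ?Q = "grid_cube h k \<inter> torus_cell L :: (real^'n) set"
  have spaceD: "space D = torus_cell L"
    by (simp add: D_def torus_measure_def space_restrict_space)
  have Q: "?Q \<in> sets D"
    using grid_cube_borel[of h k] by (auto simp: D_def torus_measure_def sets_restrict_space)
  have le: "emeasure D ?Q \<le> ennreal (R * h ^ CARD('n))"
    unfolding D_def by (rule density_grid_cube_le[OF rho h(1) R])
  then have "emeasure D ?Q < \<infinity>" using order.strict_trans1 by fastforce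
  then have int: "integrable D (\<lambda>y. 4 ^ CARD('n) * indicator ?Q y :: real)"
    using Q by (intro integrable_mult_right) (auto simp: integrable_indicator_iff)
  have "(\<integral>y. (norm (cube_test_function N r h kl y))\<^sup>2 \<partial>D) \<le> (\<integral>y. 4 ^ CARD('n) * indicator ?Q y \<partial>D)"
  proof (rule integral_mono')
    fix y assume "y \<in> space D"
    then have "norm (cube_test_function N r h kl y) \<le> 2 ^ CARD('n) * indicator ?Q y"
      using norm_cube_test_function[OF r h(2), of N k l y] by (simp add: kl spaceD indicator_def)
    then have "(norm (cube_test_function N r h kl y))\<^sup>2 \<le> (2 ^ CARD('n) * indicator ?Q y)\<^sup>2"
      by (intro power_mono) auto
    also have "\<dots> = 4 ^ CARD('n) * indicator ?Q y"
      by (auto simp: indicator_def power_mult[symmetric] power_even_eq[symmetric] power_mult_distrib[symmetric] power2_eq_square)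
    finally show "(norm (cube_test_function N r h kl y))\<^sup>2 \<le> 4 ^ CARD('n) * indicator ?Q y" .
  qed (use int in auto)
  also have "\<dots> = 4 ^ CARD('n) * measure D ?Q"
    using Q by simp
  also have "\<dots> \<le> 4 ^ CARD('n) * (R * h ^ CARD('n))"
    using le R h by (intro mult_left_mono) (auto simp: measure_def enn2real_leI)
  finally show ?thesis .
qed

section \<open>The deviation bound\<close>

text \<open>
  The supremum over \<open>\<phi>\<close> and \<open>x\<close> has been replaced by a finite family: outside the union of the
  deviation events of the test functions the error is at most \<open>c\<close>.
\<close>

lemma kernel_error_tail_finite_net:
  fixes \<rho> :: "real^'n \<Rightarrow> real" and X :: "nat \<Rightarrow> 'a \<Rightarrow> real^'n" and n N M :: nat
  assumes rho: "bounded_density L R \<rho>" and iid: "iid_sample P L \<rho> M X"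
    and pos: "L > 0" "\<epsilon> > 0" "Z\<^sub>0 > 0" "n > 0" "N > 0" "M > 0" "R \<ge> 0"
    and S: "\<And>(y :: real^'n) F. finite F \<Longrightarrow> (\<Sum>j\<in>F. exp (- (\<kappa> * (norm (y + lattice_point j))\<^sup>2))) \<le> S"
  defines "\<zeta> \<equiv> Z\<^sub>0 * sqrt \<epsilon>" and "h \<equiv> L / real n"
  defines "A \<equiv> (pi * \<epsilon>) powr (- (real CARD('n) / 2)) * exp (real CARD('n) * (\<zeta> / 2)\<^sup>2 / \<epsilon>) * S"
  assumes h: "h \<le> \<zeta> / 4" "\<kappa> \<le> 1 / (2 * \<epsilon>) * h\<^sup>2"
    and t: "t \<ge> 0" and c: "A * (2 * t) + 2 * (2 ^ CARD('n) * 6 / 2 ^ N * A) \<le> c"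
    and s: "0 \<le> s" "s * 2 ^ CARD('n) \<le> 1"
  shows "measure P {\<omega> \<in> space P. kernel_error L Z\<^sub>0 \<epsilon> \<rho> M (\<lambda>i. X i \<omega>) > ereal c}
    \<le> 4 * real (n ^ CARD('n) * N ^ CARD('n)) * exp (real M * (s\<^sup>2 * (R * \<zeta> ^ CARD('n)) - s * t))"
proof -
  let ?K = "PiE UNIV (\<lambda>_. {..<n}) :: ('n \<Rightarrow> nat) set"
  let ?N = "PiE UNIV (\<lambda>_. {..<N}) :: ('n \<Rightarrow> nat) set"
  let ?T = "torus_measure L :: (real^'n) measure"
  define D where "D = density ?T (\<lambda>x. ennreal (\<rho> x))"
  interpret P: prob_space P using iid by (simp add: iid_sample_def)
  have indep: "P.indep_vars (\<lambda>_. ?T) X {1..M}" using iid by (simp add: iid_sample_def)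
  have distr: "distr P ?T (X i) = D" if "i \<in> {1..M}" for i
    using iid that unfolding iid_sample_def D_def by (intro distributed_distr_eq_density) auto
  have rv: "X i \<in> measurable P ?T" if "i \<in> {1..M}" for i
    using indep that by (auto simp: P.indep_vars_def)
  have zeta: "\<zeta> > 0" using pos by (simp add: \<zeta>_def)
  have h0: "h \<ge> 0" using pos by (simp add: h_def)
  have card: "card (?K \<times> ?N) = n ^ CARD('n) * N ^ CARD('n)" by (subst card_cartesian_product) (simp add: card_PiE)
  have fin: "finite (?K \<times> ?N)" by (simp add: finite_PiE)
  have "measure P {\<omega> \<in> space P. kernel_error L Z\<^sub>0 \<epsilon> \<rho> M (\<lambda>i. X i \<omega>) > ereal c}
      \<le> 4 * real (card (?K \<times> ?N)) * exp (real M * (s\<^sup>2 * (R * \<zeta> ^ CARD('n)) - s * t))"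
  proof (rule P.empirical_deviation_union_bound[OF indep pos(6) distr fin,
        where \<psi> = "cube_test_function N (\<zeta> / 4) h" and B = "2 ^ CARD('n)"])
    show "cube_test_function N (\<zeta> / 4) h kl \<in> borel_measurable ?T" for kl
      using borel_measurable_cube_test_function[of "\<zeta> / 4" N h kl] zeta
      unfolding torus_measure_def by (auto intro!: measurable_restrict_space1)
    show "norm (cube_test_function N (\<zeta> / 4) h kl y) \<le> 2 ^ CARD('n)" for kl and y :: "real^'n"
    proof -
      obtain k l where kl: "kl = (k, l)" by (cases kl)
      show ?thesis
        using norm_cube_test_function[of "\<zeta> / 4" h N k l y, OF _ h(1)] zeta
        unfolding kl by (cases "y \<in> grid_cube h k") (simp_all add: order_trans)
    qed
    show "(\<integral>y. (norm (cube_test_function N (\<zeta> / 4) h kl y))\<^sup>2 \<partial>D) \<le> R * \<zeta> ^ CARD('n)" for kl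
    proof -
      have "(\<integral>y. (norm (cube_test_function N (\<zeta> / 4) h kl y))\<^sup>2 \<partial>D) \<le> 4 ^ CARD('n) * (R * h ^ CARD('n))"
        unfolding D_def by (rule cube_test_function_second_moment[OF rho _ h0 h(1) pos(7)]) (use zeta in simp)
      also have "\<dots> = R * (4 * h) ^ CARD('n)" by (simp add: power_mult_distrib)
      also have "\<dots> \<le> R * \<zeta> ^ CARD('n)"
        using h(1) h0 pos(7) by (intro mult_left_mono power_mono) auto
      finally show ?thesis .
    qed
    fix \<omega>
    assume "\<omega> \<in> {\<omega> \<in> space P. kernel_error L Z\<^sub>0 \<epsilon> \<rho> M (\<lambda>i. X i \<omega>) > ereal c}"
    then have w: "\<omega> \<in> space P" and gt: "kernel_error L Z\<^sub>0 \<epsilon> \<rho> M (\<lambda>i. X i \<omega>) > ereal c" by auto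
    have pts: "X i \<omega> \<in> torus_cell L" if "i \<in> {1..M}" for i
      using measurable_space[OF rv[OF that] w] by (simp add: torus_measure_def space_restrict_space)
    show "\<omega> \<in> space P \<and> (\<exists>i\<in>?K \<times> ?N. norm (1 / of_nat M * (\<Sum>m\<in>{1..M}. cube_test_function N (\<zeta> / 4) h i (X m \<omega>))
        - (\<integral>x. cube_test_function N (\<zeta> / 4) h i x \<partial>D)) > 2 * t)"
    proof (rule ccontr)
      assume neg: "\<not> ?thesis"
      have "kernel_error L Z\<^sub>0 \<epsilon> \<rho> M (\<lambda>i. X i \<omega>) \<le> ereal (A * (2 * t) + 2 * (2 ^ CARD('n) * 6 / 2 ^ N * A))"
        unfolding A_def \<zeta>_def
      proof (rule kernel_error_le[OF rho pos(1-6) pts S h[unfolded \<zeta>_def h_def]])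
        fix kl :: "('n \<Rightarrow> nat) \<times> ('n \<Rightarrow> nat)" assume "kl \<in> ?K \<times> ?N"
        then show "norm (1 / of_nat M * (\<Sum>m\<in>{1..M}. cube_test_function N (Z\<^sub>0 * sqrt \<epsilon> / 4) (L / real n) kl (X m \<omega>))
          - (\<integral>y. cube_test_function N (Z\<^sub>0 * sqrt \<epsilon> / 4) (L / real n) kl y \<partial>density ?T (\<lambda>x. ennreal (\<rho> x)))) \<le> 2 * t"
          using neg w unfolding \<zeta>_def h_def D_def not_le[symmetric] by blast
      qed (use t in auto)
      also have "\<dots> \<le> ereal c" using c by simp
      finally show False using gt by simp
    qed
  qed (use s in auto)
  then show ?thesis unfolding card .
qed

text \<open>
  Used to absorb the number of test functions into the exponential of the logarithmic factor.
\<close>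

lemma power_of_affine_exp_bound:
  fixes x K p l :: real
  assumes "0 \<le> x" "x \<le> K * exp (p * l) + 1" "K > 0" "p \<ge> 0" "l \<ge> 1"
  shows "x ^ d \<le> exp (real d * (K + p) * l)"
proof -
  have "1 \<le> exp (p * l)" using assms by simp
  then have "x \<le> (1 + K) * exp (p * l)" using assms(2) unfolding distrib_right by linarith
  also have "\<dots> \<le> exp K * exp (p * l)" by (intro mult_right_mono exp_ge_add_one_self) auto
  also have "\<dots> \<le> exp (K * l) * exp (p * l)" using assms by (intro mult_right_mono) auto
  also have "\<dots> = exp ((K + p) * l)" by (simp add: exp_add[symmetric] algebra_simps)
  finally have "x ^ d \<le> exp ((K + p) * l) ^ d" using assms(1) by (rule power_mono)
  then show ?thesis by (simp add: exp_of_nat_mult[symmetric] mult.assoc)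
qed

theorem theorem3p1:
  fixes L R \<epsilon>\<^sub>0 Z\<^sub>0 :: real
  assumes "L > 0" and "\<epsilon>\<^sub>0 > 0" and "Z\<^sub>0 > 0"
  shows "\<exists>C\<^sub>1 > 0. \<exists>C\<^sub>2 > 0.
    \<forall>(\<rho> :: real^'n \<Rightarrow> real) (P :: 'a measure) (X :: nat \<Rightarrow> 'a \<Rightarrow> real^'n) (M :: nat) (\<epsilon> :: real) (c :: real).
      bounded_density L R \<rho> \<longrightarrow> M \<ge> 1 \<longrightarrow> iid_sample P L \<rho> M X \<longrightarrow>
      0 < \<epsilon> \<longrightarrow> \<epsilon> < \<epsilon>\<^sub>0 \<longrightarrow> 0 < c \<longrightarrow> c < 3 / 4 * R \<longrightarrow>
      measure P {\<omega> \<in> space P. kernel_error L Z\<^sub>0 \<epsilon> \<rho> M (\<lambda>i. X i \<omega>) > ereal c}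
        \<le> exp (C\<^sub>1 * log_factor c \<epsilon> ^ (2 * CARD('n) + 1)
               - C\<^sub>2 * real M * \<epsilon> powr (real CARD('n) / 2) * c\<^sup>2)"
proof (cases "R > 0")
  case False
  then have "\<not> (0 < c \<and> c < 3 / 4 * R)" for c by linarith
  then show ?thesis by (meson zero_less_one)
next
  case R: True
  define d where "d = CARD('n)"
  have d: "real d \<ge> 1" by (simp add: d_def Suc_le_eq)
  \<comment> \<open>With \<open>n\<close> chosen below, \<open>h / sqrt \<epsilon>\<close> is at least \<open>Z\<^sub>0 / (4 + Z\<^sub>0 * sqrt \<epsilon>\<^sub>0 / L)\<close>, so this \<open>\<kappa>\<close> is a
     lower bound for the decay rate \<open>h\<^sup>2 / (2 * \<epsilon>)\<close> that is uniform in \<open>\<epsilon> < \<epsilon>\<^sub>0\<close>.\<close>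
  define \<kappa> where "\<kappa> = (Z\<^sub>0 / (4 + Z\<^sub>0 * sqrt \<epsilon>\<^sub>0 / L))\<^sup>2 / 2"
  have den: "4 + Z\<^sub>0 * sqrt \<epsilon>\<^sub>0 / L > 0" using assms by (simp add: add_pos_nonneg)
  then have "\<kappa> > 0" using assms by (simp add: \<kappa>_def)
  then obtain S where S0: "S > 0"
    and S: "\<And>(x :: real^'n) F. finite F \<Longrightarrow> (\<Sum>j\<in>F. exp (- (\<kappa> * (norm (x + lattice_point j))\<^sup>2))) \<le> S"
    using lattice_gauss_sum_bounded[where ?'n = 'n, of \<kappa>] by blast
  define Ca where "Ca = pi powr (- (real d / 2)) * exp (real d * Z\<^sub>0\<^sup>2 / 4) * S"
  have Ca: "Ca > 0" using S0 by (simp add: Ca_def)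
  \<comment> \<open>The Chernoff parameter will be \<open>s0 * c\<close>. The first entry of the minimum keeps the quadratic term of
     the exponent at most half of the linear one. The second is the admissibility condition that the
     parameter times the range \<open>2 ^ d\<close> is at most 1, for which \<open>c < 3 / 4 * R\<close> is used.\<close>
  define s0 where "s0 = min (1 / (8 * Ca * (R * Z\<^sub>0 ^ d))) (4 / (3 * R * 2 ^ d))"
  have RZ: "R * Z\<^sub>0 ^ d > 0" using R assms by simp
  have s0: "s0 > 0" using Ca RZ R by (simp add: s0_def)
  have s0a: "s0 * (R * Z\<^sub>0 ^ d) \<le> 1 / (8 * Ca)"
  proof -
    have "s0 \<le> 1 / (8 * Ca * (R * Z\<^sub>0 ^ d))" by (simp add: s0_def)
    then have "s0 * (R * Z\<^sub>0 ^ d) \<le> 1 / (8 * Ca * (R * Z\<^sub>0 ^ d)) * (R * Z\<^sub>0 ^ d)"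
      using RZ by (intro mult_right_mono) auto
    also have "\<dots> = 1 / (8 * Ca)"
    proof -
      have "1 / (8 * Ca * q) * q = 1 / (8 * Ca)" if "q > 0" for q :: real using that by simp
      then show ?thesis using RZ by blast
    qed
    finally show ?thesis .
  qed
  have s0b: "s0 * (3 / 4 * R) * 2 ^ d \<le> 1"
  proof -
    have "s0 * (3 / 4 * R * 2 ^ d) \<le> 4 / (3 * R * 2 ^ d) * (3 / 4 * R * 2 ^ d)"
      using R by (intro mult_right_mono) (auto simp: s0_def)
    also have "\<dots> = 1" using R by simp
    finally show ?thesis by (simp add: mult.assoc)
  qed
  \<comment> \<open>The logarithmic factor bounds only the sum \<open>ln (1 / c) + ln (1 / \<epsilon>)\<close>. Since \<open>c\<close> and \<open>\<epsilon>\<close> are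
     bounded above, each summand separately is at most a constant times that factor.\<close>
  define a where "a = 1 + \<bar>ln (3 / 4 * R)\<bar>"
  define b where "b = 1 + \<bar>ln \<epsilon>\<^sub>0\<bar>"
  define K1 where "K1 = 4 * L / Z\<^sub>0"
  define K2 where "K2 = 24 * 2 ^ d * Ca"
  have K: "K1 > 0" "K2 > 0" using assms Ca by (simp_all add: K1_def K2_def)
  have ab: "a \<ge> 1" "b \<ge> 1" by (simp_all add: a_def b_def)
  define C1 where "C1 = 2 + real d * (K1 + a) + real d * (K2 + (real d * a + b))"
  define C2 where "C2 = s0 / (8 * Ca)"
  have C1: "C1 > 0" unfolding C1_def using K ab d by (intro add_pos_nonneg mult_nonneg_nonneg add_nonneg_nonneg) auto
  have C2: "C2 > 0" using s0 Ca by (simp add: C2_def)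
  have main: "measure P {\<omega> \<in> space P. kernel_error L Z\<^sub>0 \<epsilon> \<rho> M (\<lambda>i. X i \<omega>) > ereal c}
        \<le> exp (C1 * log_factor c \<epsilon> ^ (2 * CARD('n) + 1) - C2 * real M * \<epsilon> powr (real CARD('n) / 2) * c\<^sup>2)"
    if rho: "bounded_density L R \<rho>" and M: "M \<ge> 1" and iid: "iid_sample P L \<rho> M X"
      and eps: "0 < \<epsilon>" "\<epsilon> < \<epsilon>\<^sub>0" and c: "0 < c" "c < 3 / 4 * R"
    for \<rho> :: "real^'n \<Rightarrow> real" and P :: "'a measure" and X :: "nat \<Rightarrow> 'a \<Rightarrow> real^'n" and M :: nat and \<epsilon> c :: real
  proof -
    define \<zeta> where "\<zeta> = Z\<^sub>0 * sqrt \<epsilon>"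
    have zeta: "\<zeta> > 0" using assms eps by (simp add: \<zeta>_def)
    define n where "n = nat \<lceil>4 * L / \<zeta>\<rceil>"
    have Lz: "4 * L / \<zeta> > 0" using assms zeta by simp
    have n1: "4 * L / \<zeta> \<le> real n" "real n \<le> 4 * L / \<zeta> + 1"
      using Lz unfolding n_def by linarith+
    have n0: "n > 0" using Lz n1 by (cases n) auto
    define h where "h = L / real n"
    have h1: "h \<le> \<zeta> / 4"
      using n1(1) n0 zeta by (simp add: h_def field_simps)
    have h2: "\<kappa> \<le> 1 / (2 * \<epsilon>) * h\<^sup>2"
    proof -
      have "sqrt \<epsilon> * (Z\<^sub>0 / (4 + Z\<^sub>0 * sqrt \<epsilon>\<^sub>0 / L)) \<le> \<zeta> / (4 + \<zeta> / L)"
      proof -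
        have "\<zeta> / L \<le> Z\<^sub>0 * sqrt \<epsilon>\<^sub>0 / L"
          unfolding \<zeta>_def using assms eps by (intro divide_right_mono mult_left_mono) auto
        then have "\<zeta> / (4 + Z\<^sub>0 * sqrt \<epsilon>\<^sub>0 / L) \<le> \<zeta> / (4 + \<zeta> / L)"
          using zeta assms by (intro divide_left_mono mult_pos_pos add_pos_nonneg) auto
        then show ?thesis by (simp add: \<zeta>_def mult_ac)
      qed
      also have "\<zeta> / (4 + \<zeta> / L) = L / (4 * L / \<zeta> + 1)"
        using zeta assms by (simp add: field_simps)
      also have "\<dots> \<le> h"
        unfolding h_def using n1 n0 Lz assms by (intro divide_left_mono mult_pos_pos) auto
      finally have "(sqrt \<epsilon> * (Z\<^sub>0 / (4 + Z\<^sub>0 * sqrt \<epsilon>\<^sub>0 / L)))\<^sup>2 \<le> h\<^sup>2"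
        using assms eps den by (intro power_mono mult_nonneg_nonneg divide_nonneg_nonneg) auto
      then have "\<epsilon> * (2 * \<kappa>) \<le> h\<^sup>2"
        unfolding power_mult_distrib using eps by (simp add: \<kappa>_def)
      then show ?thesis using eps by (simp add: field_simps)
    qed
    define E where "E = \<epsilon> powr (real d / 2)"
    have E: "E > 0" using eps by (simp add: E_def)
    define A where "A = (pi * \<epsilon>) powr (- (real CARD('n) / 2)) * exp (real CARD('n) * (\<zeta> / 2)\<^sup>2 / \<epsilon>) * S"
    have A_eq: "A = Ca / E"
    proof -
      have e: "real d * (\<zeta> / 2)\<^sup>2 / \<epsilon> = real d * Z\<^sub>0\<^sup>2 / 4"
        using eps by (simp add: \<zeta>_def power_mult_distrib power_divide)
      have p: "(pi * \<epsilon>) powr (- (real d / 2)) = pi powr (- (real d / 2)) / E"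
      proof -
        have "(pi * \<epsilon>) powr (- (real d / 2)) = pi powr (- (real d / 2)) * \<epsilon> powr (- (real d / 2))"
          by (rule powr_mult)
        also have "\<epsilon> powr (- (real d / 2)) = 1 / E"
          unfolding E_def by (rule powr_minus_divide)
        finally show ?thesis by simp
      qed
      have "A = (pi * \<epsilon>) powr (- (real d / 2)) * exp (real d * (\<zeta> / 2)\<^sup>2 / \<epsilon>) * S"
        by (simp only: A_def d_def)
      also have "\<dots> = Ca / E" unfolding e p Ca_def by simp
      finally show ?thesis .
    qed
    have A: "A > 0" using Ca E by (simp add: A_eq)
    \<comment> \<open>Any \<open>N\<close> with \<open>2 ^ N \<ge> 24 * 2 ^ d * A / c\<close> makes the truncation error at most \<open>c / 2\<close>. Taking \<open>N\<close>
       itself that large is wasteful but still polynomial in \<open>1 / \<epsilon>\<close> and \<open>1 / c\<close>.\<close>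
    define N where "N = nat \<lceil>24 * 2 ^ d * A / c\<rceil>"
    have X0: "24 * 2 ^ d * A / c > 0" using A c by simp
    have N1: "24 * 2 ^ d * A / c \<le> real N" "real N \<le> 24 * 2 ^ d * A / c + 1"
      using X0 unfolding N_def by linarith+
    have N0: "N > 0" using X0 N1 by (cases N) auto
    define t where "t = c / (4 * A)"
    have t: "t \<ge> 0" using c A by (simp add: t_def)
    have level: "A * (2 * t) + 2 * (2 ^ CARD('n) * 6 / 2 ^ N * A) \<le> c"
    proof -
      have "real N \<le> 2 ^ N" by (rule less_imp_le[OF of_nat_less_two_power])
      then have "24 * 2 ^ d * A / c \<le> 2 ^ N" using N1 by linarith
      then have "24 * 2 ^ d * A \<le> c * 2 ^ N" using c by (simp add: field_simps)
      then have "2 * (2 ^ d * 6 / 2 ^ N * A) \<le> c / 2" by (simp add: field_simps)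
      moreover have "A * (2 * t) = c / 2" using A by (simp add: t_def)
      ultimately show ?thesis unfolding d_def by linarith
    qed
    define s where "s = s0 * c"
    have s1: "0 \<le> s" using s0 c by (simp add: s_def)
    have s2: "s * 2 ^ CARD('n) \<le> 1"
    proof -
      have "s0 * c * 2 ^ d \<le> s0 * (3 / 4 * R) * 2 ^ d"
        using s0 c by (intro mult_right_mono mult_left_mono) auto
      then show ?thesis using s0b unfolding s_def d_def by linarith
    qed
    have bound: "measure P {\<omega> \<in> space P. kernel_error L Z\<^sub>0 \<epsilon> \<rho> M (\<lambda>i. X i \<omega>) > ereal c}
      \<le> 4 * real (n ^ CARD('n) * N ^ CARD('n)) * exp (real M * (s\<^sup>2 * (R * \<zeta> ^ CARD('n)) - s * t))"
      using kernel_error_tail_finite_net[OF rho iid assms(1) eps(1) assms(3) n0 N0 _ _ S, of t c s]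
        h1 h2 t level s1 s2 M R
      unfolding h_def \<zeta>_def A_def by simp
    have expo: "real M * (s\<^sup>2 * (R * \<zeta> ^ CARD('n)) - s * t) \<le> - (C2 * real M * E * c\<^sup>2)"
    proof -
      have z: "\<zeta> ^ d = Z\<^sub>0 ^ d * E"
      proof -
        have "sqrt \<epsilon> ^ d = E"
          using eps by (simp add: E_def powr_half_sqrt[symmetric] powr_powr powr_realpow[symmetric])
        then show ?thesis by (simp add: \<zeta>_def power_mult_distrib)
      qed
      have "s\<^sup>2 * (R * \<zeta> ^ d) = s0 * (s0 * (R * Z\<^sub>0 ^ d)) * (E * c\<^sup>2)"
        by (simp add: z s_def power2_eq_square)
      also have "\<dots> \<le> s0 * (1 / (8 * Ca)) * (E * c\<^sup>2)"
        using s0 s0a E by (intro mult_right_mono mult_left_mono) auto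
      finally have 1: "s\<^sup>2 * (R * \<zeta> ^ d) \<le> C2 * (E * c\<^sup>2)" by (simp add: C2_def)
      have 2: "s * t = 2 * C2 * (E * c\<^sup>2)"
        using E Ca by (simp add: s_def t_def A_eq C2_def power2_eq_square)
      have "real M * (s\<^sup>2 * (R * \<zeta> ^ d) - s * t) \<le> real M * (- (C2 * (E * c\<^sup>2)))"
        using 1 2 by (intro mult_left_mono) auto
      then show ?thesis by (simp add: d_def mult_ac)
    qed
    define l where "l = log_factor c \<epsilon>"
    have l: "l \<ge> 1" "ln (1 / c) + ln (1 / \<epsilon>) \<le> l" by (simp_all add: l_def log_factor_def)
    have le: "ln (1 / \<epsilon>) \<le> a * l"
    proof -
      have "ln c \<le> ln (3 / 4 * R)" using c by simp
      moreover have "ln (1 / c) = - ln c" using c by (simp add: ln_div)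
      ultimately have "- ln (1 / c) \<le> \<bar>ln (3 / 4 * R)\<bar> * 1" by linarith
      also have "\<dots> \<le> \<bar>ln (3 / 4 * R)\<bar> * l" using l by (intro mult_left_mono) auto
      finally show ?thesis using l by (simp add: a_def algebra_simps)
    qed
    have lc: "ln (1 / c) \<le> b * l"
    proof -
      have "ln \<epsilon> \<le> ln \<epsilon>\<^sub>0" using eps by simp
      moreover have "ln (1 / \<epsilon>) = - ln \<epsilon>" using eps by (simp add: ln_div)
      ultimately have "- ln (1 / \<epsilon>) \<le> \<bar>ln \<epsilon>\<^sub>0\<bar> * 1" by linarith
      also have "\<dots> \<le> \<bar>ln \<epsilon>\<^sub>0\<bar> * l" using l by (intro mult_left_mono) auto
      finally show ?thesis using l by (simp add: b_def algebra_simps)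
    qed
    have al: "0 \<le> a * l" using ab l by simp
    have root: "\<epsilon> powr (- p) \<le> exp (p' * (a * l))" if "0 \<le> p" "p \<le> p'" for p p'
    proof -
      have "- p * ln \<epsilon> = p * ln (1 / \<epsilon>)" using eps by (simp add: ln_div)
      also have "\<dots> \<le> p * (a * l)" using le that by (intro mult_left_mono) auto
      also have "\<dots> \<le> p' * (a * l)" using al that by (intro mult_right_mono) auto
      finally show ?thesis using eps by (simp add: powr_def)
    qed
    have nb: "real n ^ d \<le> exp (real d * (K1 + a) * l)"
    proof (rule power_of_affine_exp_bound)
      have "4 * L / \<zeta> = K1 * \<epsilon> powr (- (1 / 2))"
        using eps by (simp add: K1_def \<zeta>_def powr_minus_divide powr_half_sqrt)
      also have "\<dots> \<le> K1 * exp (1 * (a * l))"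
        using K by (intro mult_left_mono root) auto
      finally show "real n \<le> K1 * exp (a * l) + 1" using n1 by simp
    qed (use K ab l in auto)
    have Nb: "real N ^ d \<le> exp (real d * (K2 + (real d * a + b)) * l)"
    proof (rule power_of_affine_exp_bound)
      have "24 * 2 ^ d * A / c = K2 * (\<epsilon> powr (- (real d / 2)) * (1 / c))"
        using eps by (simp add: K2_def A_eq E_def powr_minus_divide)
      also have "\<dots> \<le> K2 * (exp (real d * (a * l)) * exp (b * l))"
      proof (intro mult_left_mono mult_mono root)
        have "1 / c = exp (ln (1 / c))" using c by simp
        also have "\<dots> \<le> exp (b * l)" using lc by simp
        finally show "1 / c \<le> exp (b * l)" .
      qed (use c K in auto)
      also have "\<dots> = K2 * exp ((real d * a + b) * l)"
        by (simp add: exp_add[symmetric] algebra_simps)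
      finally show "real N \<le> K2 * exp ((real d * a + b) * l) + 1" using N1 by simp
    qed (use K ab l in auto)
    have four: "4 \<le> exp (2 * l)"
    proof -
      have "(2 :: real) \<le> exp 1" using exp_ge_add_one_self[of 1] by simp
      then have "2 ^ 2 \<le> exp (1 :: real) ^ 2" by (rule power_mono) simp
      then have "4 \<le> exp (2 :: real)" by (simp add: exp_of_nat_mult[symmetric])
      also have "\<dots> \<le> exp (2 * l)" using l by simp
      finally show ?thesis .
    qed
    have "4 * real (n ^ d * N ^ d) = 4 * (real n ^ d * real N ^ d)" by simp
    also have "\<dots> \<le> exp (2 * l) * (exp (real d * (K1 + a) * l) * exp (real d * (K2 + (real d * a + b)) * l))"
      by (intro mult_mono four nb Nb) auto
    also have "\<dots> = exp (C1 * l)"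
      by (simp add: C1_def exp_add[symmetric] distrib_right)
    also have "\<dots> \<le> exp (C1 * l ^ (2 * d + 1))"
    proof -
      have "l \<le> l ^ (2 * d + 1)" using l(1) by (intro self_le_power) auto
      then show ?thesis using C1 by simp
    qed
    finally have count: "4 * real (n ^ d * N ^ d) \<le> exp (C1 * l ^ (2 * d + 1))" .
    have "4 * real (n ^ d * N ^ d) * exp (real M * (s\<^sup>2 * (R * \<zeta> ^ d) - s * t))
        \<le> exp (C1 * l ^ (2 * d + 1)) * exp (- (C2 * real M * E * c\<^sup>2))"
      using expo by (intro mult_mono count) (auto simp: d_def)
    also have "\<dots> = exp (C1 * l ^ (2 * d + 1) - C2 * real M * E * c\<^sup>2)"
      by (simp add: exp_add[symmetric])
    finally show ?thesis
      using bound unfolding d_def[symmetric] E_def l_def by linarith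
  qed
  show ?thesis
  proof (rule exI[of _ C1], rule conjI[OF C1], rule exI[of _ C2], rule conjI[OF C2], intro allI impI)
    fix \<rho> :: "real^'n \<Rightarrow> real" and P :: "'a measure" and X :: "nat \<Rightarrow> 'a \<Rightarrow> real^'n" and M :: nat and \<epsilon> c :: real
    assume "bounded_density L R \<rho>" "M \<ge> 1" "iid_sample P L \<rho> M X" "0 < \<epsilon>" "\<epsilon> < \<epsilon>\<^sub>0" "0 < c" "c < 3 / 4 * R"
    then show "measure P {\<omega> \<in> space P. kernel_error L Z\<^sub>0 \<epsilon> \<rho> M (\<lambda>i. X i \<omega>) > ereal c}
        \<le> exp (C1 * log_factor c \<epsilon> ^ (2 * CARD('n) + 1) - C2 * real M * \<epsilon> powr (real CARD('n) / 2) * c\<^sup>2)"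
      by (rule main)
  qed
qed

end
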